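(* Let $\mathcal{C}$ be a strict monoidal category, $J\in\mathcal{C}$, and let $\mathcal{C}[J^{\vee}]$ be as in the context. Let $n>0$, let $U=U_0$ be an object of $\mathcal{C}$ regarded as an object of $\mathcal{C}[J^{\vee}]$, and let $V=(V_0,V_1,\dots,V_n):[n]\to\mathrm{ob}\,\mathcal{C}$ be an object of $\mathcal{C}[J^{\vee}]$, with $V\partial_0=(V_1,\dots,V_n):[n-1]\to\mathrm{ob}\,\mathcal{C}$. Then the function $$\zeta_{0,n}:\int^{Y\in\mathcal{C}}\mathcal{C}(U_0,V_0\otimes Y)\times\mathcal{C}[J^{\vee}](J\otimes Y,V\partial_0)\longrightarrow\mathcal{C}[J^{\vee}](U,V)$$ taking the equivalence class of $(U_0\xrightarrow{f}V_0\otimes Y,\;J\otimes Y\xrightarrow{g}V\partial_0)$ to the composite $$U=U_0\xrightarrow{f}V_0\otimes Y\xrightarrow{1\otimes\eta\otimes1}V_0\otimes J^{\vee}\otimes J\otimes Y\xrightarrow{1\otimes1\otimes g}V_0\otimes J^{\vee}\otimes V\partial_0=V$$ is invertible.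
   Context: Construction of $\mathcal{C}[J^{\vee}]$. Let $\mathcal{C}$ be a strict monoidal category with tensor $\otimes$ and unit $\mathbb{I}$, and let $J\in\mathcal{C}$. Write $[m]=\{0,1,\dots,m\}$. Let $\mathcal{G}_0$ be the set of all functions $U:[m]\to \mathrm{ob}\,\mathcal{C}$ ($m\ge 0$), written $U=(U_0,\dots,U_m)$; objects of $\mathcal{C}$ are identified with functions $[0]\to\mathrm{ob}\,\mathcal{C}$. For $U:[m]\to\mathrm{ob}\,\mathcal{C}$ and $V:[n]\to\mathrm{ob}\,\mathcal{C}$ define $U\otimes V:[m+n]\to\mathrm{ob}\,\mathcal{C}$ by $(U\otimes V)_i=U_i$ for $i<m$, $(U\otimes V)_m=U_m\otimes V_0$, $(U\otimes V)_i=V_{i-m}$ for $i>m$. This makes $\mathcal{G}_0$ a monoid with unit $\mathbb{I}$. Put $J^{\vee}=(\mathbb{I},\mathbb{I}):[1]\to\mathrm{ob}\,\mathcal{C}$; then every $U$ decomposes uniquely as $U=U_0\otimes J^{\vee}\otimes U_1\otimes J^{\vee}\otimes\dots\otimes J^{\vee}\otimes U_m$ with $U_i\in\mathcal{C}$. Let $\mathcal{G}$ be the directed graph with vertex set $\mathcal{G}_0$ and the following edges. The primitive edges are symbols $\varepsilon: J\otimes J^{\vee}\to\mathbb{I}$, $\eta:\mathbb{I}\to J^{\vee}\otimes J$, and $\bar f: C\to D$ for each morphism $f:C\to D$ of $\mathcal{C}$. The general edges are the formal whiskerings $U\otimes p\otimes V: U\otimes A\otimes V\to U\otimes B\otimes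 V$ with $p:A\to B$ primitive and $U,V\in\mathcal{G}_0$ (with $p$ identified with $\mathbb{I}\otimes p\otimes\mathbb{I}$); put $T\otimes(U\otimes p\otimes V)\otimes W=(T\otimes U)\otimes p\otimes(V\otimes W)$ and extend $U\otimes -\otimes V$ to paths edge by edge. Let $\mathcal{F}\mathcal{G}$ be the free category on $\mathcal{G}$, and let $\sim$ be the congruence on $\mathcal{F}\mathcal{G}$ generated by the following relations ($C,D,E,F\in\mathcal{C}$; $U,V,W,X,Y,Z\in\mathcal{G}_0$): (i) $\overline{E\otimes f\otimes F}\sim E\otimes\bar f\otimes F$ for $f\in\mathcal{C}(C,D)$; (ii) $\overline{1_C}\sim 1_C$, and $\overline{gf}\sim\bar g\,\bar f$ for $f\in\mathcal{C}(C,D)$, $g\in\mathcal{C}(D,E)$; (iii) $(V\otimes b)(a\otimes W)\sim(a\otimes X)(U\otimes b)$ for all edges $a:U\to V$, $b:W\to X$; (iv) $(\varepsilon\otimes J)(J\otimes\eta)\sim 1_J$; (v) $(J^{\vee}\otimes\varepsilon)(\eta\otimes J^{\vee})\sim 1_{J^{\vee}}$; (vi) if $\ell\sim\ell'$ is any of the relations (i)–(v), then $Y\otimes\ell\otimes Z\sim Y\otimes\ell'\otimes Z$. Put $\mathcal{C}[J^{\vee}]=\mathcal{F}\mathcal{G}/\sim$. It is strict monoidal: the tensor of objects $U:[m]\to\mathrm{ob}\,\mathcal{C}$ and $V:[n]\to\mathrm{ob}\,\mathcal{C}$ is the product in the monoid $\mathcal{G}_0$, i.e. the function $U\otimes V:[m+n]\to\mathrm{ob}\,\mathcal{C}$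 with $(U\otimes V)_i=U_i$ for $i<m$, $(U\otimes V)_m=U_m\otimes V_0$, $(U\otimes V)_i=V_{i-m}$ for $i>m$, and for morphisms $[a]\otimes[b]$ is the class of both sides of (iii), extended to paths. The functor $\Omega:\mathcal{C}\to\mathcal{C}[J^{\vee}]$, $\Omega C=C$, $\Omega f=[\bar f]$, is strict monoidal, and $J\dashv J^{\vee}$ in $\mathcal{C}[J^{\vee}]$ with counit $\varepsilon$ and unit $\eta$. Morphisms of $\mathcal{C}$ are regarded as morphisms of $\mathcal{C}[J^{\vee}]$ via $\Omega$. *)

theory Defs
  imports "Graph_Theory.Arc_Walk"
begin

record ('o, 'm) cat =
  Obj :: "'o set"
  Arr :: "'m set"
  Dom :: "'m \<Rightarrow> 'o"
  Cod :: "'m \<Rightarrow> 'o"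
  Ident :: "'o \<Rightarrow> 'm"
  Comp :: "'m \<Rightarrow> 'm \<Rightarrow> 'm"  (infixl "\<cdot>\<index>" 65)

text \<open>Composition is written in the order \<open>g \<cdot> f\<close> (first \<open>f\<close>, then \<open>g\<close>); its value on a
  non-composable pair is irrelevant.\<close>

definition Hom :: "('o, 'm, 'z) cat_scheme \<Rightarrow> 'o \<Rightarrow> 'o \<Rightarrow> 'm set" where
  "Hom C a b = {f \<in> Arr C. Dom C f = a \<and> Cod C f = b}"

locale category =
  fixes C :: "('o, 'm, 'z) cat_scheme" (structure)
  assumes Dom_closed: "f \<in> Arr C \<Longrightarrow> Dom C f \<in> Obj C"
    and Cod_closed: "f \<in> Arr C \<Longrightarrow> Cod C f \<in> Obj C"
    and Ident_Hom: "a \<in> Obj C \<Longrightarrow> Ident C a \<in> Hom C a a"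
    and Comp_Hom: "f \<in> Hom C a b \<Longrightarrow> g \<in> Hom C b c \<Longrightarrow> g \<cdot> f \<in> Hom C a c"
    and Comp_assoc:
      "f \<in> Hom C a b \<Longrightarrow> g \<in> Hom C b c \<Longrightarrow> h \<in> Hom C c d \<Longrightarrow> h \<cdot> (g \<cdot> f) = h \<cdot> g \<cdot> f"
    and Comp_Ident_left: "f \<in> Hom C a b \<Longrightarrow> Ident C b \<cdot> f = f"
    and Comp_Ident_right: "f \<in> Hom C a b \<Longrightarrow> f \<cdot> Ident C a = f"

record ('o, 'm) monoidal_cat = "('o, 'm) cat" +
  tensor_obj :: "'o \<Rightarrow> 'o \<Rightarrow> 'o"  (infixl "\<otimes>\<^sub>o\<index>" 70)
  tensor_arr :: "'m \<Rightarrow> 'm \<Rightarrow> 'm"  (infixl "\<otimes>\<index>" 70)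
  unit_obj :: "'o"  ("\<I>\<index>")

locale strict_monoidal_category = category C
  for C :: "('o, 'm, 'z) monoidal_cat_scheme" (structure) +
  assumes unit_closed: "\<I> \<in> Obj C"
    and tensor_obj_closed: "a \<in> Obj C \<Longrightarrow> b \<in> Obj C \<Longrightarrow> a \<otimes>\<^sub>o b \<in> Obj C"
    and tensor_arr_Hom:
      "f \<in> Hom C a b \<Longrightarrow> g \<in> Hom C c d \<Longrightarrow> f \<otimes> g \<in> Hom C (a \<otimes>\<^sub>o c) (b \<otimes>\<^sub>o d)"
    and tensor_Ident:
      "a \<in> Obj C \<Longrightarrow> b \<in> Obj C \<Longrightarrow> Ident C a \<otimes> Ident C b = Ident C (a \<otimes>\<^sub>o b)"
    and tensor_Comp:
      "f \<in> Hom C a b \<Longrightarrow> f' \<in> Hom C b c \<Longrightarrow> g \<in> Hom C a' b' \<Longrightarrow> g' \<in> Hom C b' c' \<Longrightarrow>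
        (f' \<cdot> f) \<otimes> (g' \<cdot> g) = (f' \<otimes> g') \<cdot> (f \<otimes> g)"
    and tensor_obj_assoc:
      "a \<in> Obj C \<Longrightarrow> b \<in> Obj C \<Longrightarrow> c \<in> Obj C \<Longrightarrow> a \<otimes>\<^sub>o (b \<otimes>\<^sub>o c) = a \<otimes>\<^sub>o b \<otimes>\<^sub>o c"
    and tensor_arr_assoc:
      "f \<in> Arr C \<Longrightarrow> g \<in> Arr C \<Longrightarrow> h \<in> Arr C \<Longrightarrow> f \<otimes> (g \<otimes> h) = f \<otimes> g \<otimes> h"
    and unit_tensor_obj: "a \<in> Obj C \<Longrightarrow> \<I> \<otimes>\<^sub>o a = a"
    and tensor_unit_obj: "a \<in> Obj C \<Longrightarrow> a \<otimes>\<^sub>o \<I> = a"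
    and unit_tensor_arr: "f \<in> Arr C \<Longrightarrow> Ident C \<I> \<otimes> f = f"
    and tensor_unit_arr: "f \<in> Arr C \<Longrightarrow> f \<otimes> Ident C \<I> = f"


text \<open>An arrow \<open>(u, p, v)\<close> of the free category is a path \<open>p\<close> from \<open>u\<close> to \<open>v\<close>; the list of edges
  \<open>p\<close> is in the order in which they are traversed.\<close>

definition free_cat :: "('v, 'e) pre_digraph \<Rightarrow> ('v, 'v \<times> 'e list \<times> 'v) cat" where
  "free_cat G =
    \<lparr> Obj = verts G,
      Arr = {(u, p, v). pre_digraph.awalk G u p v},
      Dom = (\<lambda>(u, p, v). u),
      Cod = (\<lambda>(u, p, v). v),
      Ident = (\<lambda>u. (u, [], u)),
      Comp = (\<lambda>(v', q, w) (u, p, v). (u, p @ q, w)) \<rparr>"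

definition edge_path :: "('v, 'e) pre_digraph \<Rightarrow> 'e \<Rightarrow> 'v \<times> 'e list \<times> 'v" where
  "edge_path G e = (tail G e, [e], head G e)"

inductive congruence_gen :: "('o, 'm, 'z) cat_scheme \<Rightarrow> ('m \<Rightarrow> 'm \<Rightarrow> bool) \<Rightarrow> 'm \<Rightarrow> 'm \<Rightarrow> bool"
  for F :: "('o, 'm, 'z) cat_scheme" and R :: "'m \<Rightarrow> 'm \<Rightarrow> bool"
  where
    base: "R f g \<Longrightarrow> congruence_gen F R f g"
  | refl: "f \<in> Arr F \<Longrightarrow> congruence_gen F R f f"
  | sym: "congruence_gen F R f g \<Longrightarrow> congruence_gen F R g f"
  | trans: "congruence_gen F R f g \<Longrightarrow> congruence_gen F R g h \<Longrightarrow> congruence_gen F R f h"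
  | comp: "congruence_gen F R f f' \<Longrightarrow> congruence_gen F R g g' \<Longrightarrow> Cod F f = Dom F g \<Longrightarrow>
      congruence_gen F R (g \<cdot>\<^bsub>F\<^esub> f) (g' \<cdot>\<^bsub>F\<^esub> f')"

definition cong_class ::
  "('o, 'm, 'z) cat_scheme \<Rightarrow> ('m \<Rightarrow> 'm \<Rightarrow> bool) \<Rightarrow> 'm \<Rightarrow> 'm set" where
  "cong_class F R f = {g. congruence_gen F R f g}"

definition quotient_cat ::
  "('o, 'm, 'z) cat_scheme \<Rightarrow> ('m \<Rightarrow> 'm \<Rightarrow> bool) \<Rightarrow> ('o, 'm set) cat" where
  "quotient_cat F R =
    \<lparr> Obj = Obj F,
      Arr = cong_class F R ` Arr F,
      Dom = (\<lambda>A. the_elem (Dom F ` A)),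
      Cod = (\<lambda>A. the_elem (Cod F ` A)),
      Ident = (\<lambda>a. cong_class F R (Ident F a)),
      Comp = (\<lambda>B A. \<Union>g\<in>B. \<Union>f\<in>A. cong_class F R (g \<cdot>\<^bsub>F\<^esub> f)) \<rparr>"


text \<open>A function \<open>U : [m] \<rightarrow> Obj C\<close> is encoded as the list \<open>[U\<^sub>0, \<dots>, U\<^sub>m]\<close>
  of length \<open>m + 1\<close>; an object \<open>A\<close> of \<open>C\<close> is identified with \<open>[A]\<close>.\<close>

definition seqs :: "('o, 'm, 'z) monoidal_cat_scheme \<Rightarrow> 'o list set" where
  "seqs C = {U. U \<noteq> [] \<and> set U \<subseteq> Obj C}"

definition seq_tensor ::
  "('o, 'm, 'z) monoidal_cat_scheme \<Rightarrow> 'o list \<Rightarrow> 'o list \<Rightarrow> 'o list"  (infixl "\<odot>\<index>" 70) where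
  "U \<odot>\<^bsub>C\<^esub> V = butlast U @ [last U \<otimes>\<^sub>o\<^bsub>C\<^esub> hd V] @ tl V"

definition seq_unit :: "('o, 'm, 'z) monoidal_cat_scheme \<Rightarrow> 'o list" where
  "seq_unit C = [\<I>\<^bsub>C\<^esub>]"

definition dual_obj :: "('o, 'm, 'z) monoidal_cat_scheme \<Rightarrow> 'o list" where
  "dual_obj C = [\<I>\<^bsub>C\<^esub>, \<I>\<^bsub>C\<^esub>]"

datatype 'm prim_edge = Counit | Unit | Bar 'm

fun prim_src :: "('o, 'm, 'z) monoidal_cat_scheme \<Rightarrow> 'o \<Rightarrow> 'm prim_edge \<Rightarrow> 'o list" where
  "prim_src C J Counit = [J] \<odot>\<^bsub>C\<^esub> dual_obj C"
| "prim_src C J Unit = seq_unit C"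
| "prim_src C J (Bar f) = [Dom C f]"

fun prim_tgt :: "('o, 'm, 'z) monoidal_cat_scheme \<Rightarrow> 'o \<Rightarrow> 'm prim_edge \<Rightarrow> 'o list" where
  "prim_tgt C J Counit = seq_unit C"
| "prim_tgt C J Unit = dual_obj C \<odot>\<^bsub>C\<^esub> [J]"
| "prim_tgt C J (Bar f) = [Cod C f]"

text \<open>The edge \<open>(U, p, V)\<close> is the formal whiskering of the primitive edge \<open>p\<close> by \<open>U\<close> on the
  left and \<open>V\<close> on the right.\<close>

type_synonym ('o, 'm) edge = "'o list \<times> 'm prim_edge \<times> 'o list"
type_synonym ('o, 'm) edge_seq = "'o list \<times> ('o, 'm) edge list \<times> 'o list"

definition dual_graph ::
  "('o, 'm, 'z) monoidal_cat_scheme \<Rightarrow> 'o \<Rightarrow> ('o list, ('o, 'm) edge) pre_digraph" where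
  "dual_graph C J =
    \<lparr> verts = seqs C,
      arcs = seqs C \<times> ({Counit, Unit} \<union> Bar ` Arr C) \<times> seqs C,
      tail = (\<lambda>(U, p, V). U \<odot>\<^bsub>C\<^esub> prim_src C J p \<odot>\<^bsub>C\<^esub> V),
      head = (\<lambda>(U, p, V). U \<odot>\<^bsub>C\<^esub> prim_tgt C J p \<odot>\<^bsub>C\<^esub> V) \<rparr>"

definition free_dual_cat ::
  "('o, 'm, 'z) monoidal_cat_scheme \<Rightarrow> 'o \<Rightarrow> ('o list, ('o, 'm) edge_seq) cat" where
  "free_dual_cat C J = free_cat (dual_graph C J)"

definition prim_path ::
  "('o, 'm, 'z) monoidal_cat_scheme \<Rightarrow> 'o \<Rightarrow> 'm prim_edge \<Rightarrow> ('o, 'm) edge_seq" where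
  "prim_path C J p = edge_path (dual_graph C J) (seq_unit C, p, seq_unit C)"

definition whisker_edge ::
  "('o, 'm, 'z) monoidal_cat_scheme \<Rightarrow> 'o list \<Rightarrow> ('o, 'm) edge \<Rightarrow> 'o list \<Rightarrow> ('o, 'm) edge" where
  "whisker_edge C T e W = (case e of (U, p, V) \<Rightarrow> (T \<odot>\<^bsub>C\<^esub> U, p, V \<odot>\<^bsub>C\<^esub> W))"

definition whisker ::
  "('o, 'm, 'z) monoidal_cat_scheme \<Rightarrow> 'o list \<Rightarrow> ('o, 'm) edge_seq \<Rightarrow> 'o list \<Rightarrow> ('o, 'm) edge_seq"
  where
  "whisker C T a W = (case a of (A, es, B) \<Rightarrow>
    (T \<odot>\<^bsub>C\<^esub> A \<odot>\<^bsub>C\<^esub> W, map (\<lambda>e. whisker_edge C T e W) es, T \<odot>\<^bsub>C\<^esub> B \<odot>\<^bsub>C\<^esub> W))"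

abbreviation whisker_left ::
  "('o, 'm, 'z) monoidal_cat_scheme \<Rightarrow> 'o list \<Rightarrow> ('o, 'm) edge_seq \<Rightarrow> ('o, 'm) edge_seq" where
  "whisker_left C T a \<equiv> whisker C T a (seq_unit C)"

abbreviation whisker_right ::
  "('o, 'm, 'z) monoidal_cat_scheme \<Rightarrow> ('o, 'm) edge_seq \<Rightarrow> 'o list \<Rightarrow> ('o, 'm) edge_seq" where
  "whisker_right C a W \<equiv> whisker C (seq_unit C) a W"

inductive dual_rel ::
  "('o, 'm, 'z) monoidal_cat_scheme \<Rightarrow> 'o \<Rightarrow> ('o, 'm) edge_seq \<Rightarrow> ('o, 'm) edge_seq \<Rightarrow> bool"
  for C :: "('o, 'm, 'z) monoidal_cat_scheme" and J :: 'o
  where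
    bar_whisker: "E \<in> Obj C \<Longrightarrow> F \<in> Obj C \<Longrightarrow> f \<in> Arr C \<Longrightarrow>
      dual_rel C J
        (prim_path C J (Bar (Ident C E \<otimes>\<^bsub>C\<^esub> f \<otimes>\<^bsub>C\<^esub> Ident C F)))
        (whisker C [E] (prim_path C J (Bar f)) [F])"
  | bar_Ident: "A \<in> Obj C \<Longrightarrow>
      dual_rel C J (prim_path C J (Bar (Ident C A))) (Ident (free_dual_cat C J) [A])"
  | bar_Comp: "f \<in> Hom C A B \<Longrightarrow> g \<in> Hom C B D \<Longrightarrow>
      dual_rel C J
        (prim_path C J (Bar (g \<cdot>\<^bsub>C\<^esub> f)))
        (prim_path C J (Bar g) \<cdot>\<^bsub>free_dual_cat C J\<^esub> prim_path C J (Bar f))"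
  | interchange: "a \<in> arcs (dual_graph C J) \<Longrightarrow> b \<in> arcs (dual_graph C J) \<Longrightarrow>
      tail (dual_graph C J) a = U \<Longrightarrow> head (dual_graph C J) a = V \<Longrightarrow>
      tail (dual_graph C J) b = W \<Longrightarrow> head (dual_graph C J) b = X \<Longrightarrow>
      dual_rel C J
        (whisker_left C V (edge_path (dual_graph C J) b) \<cdot>\<^bsub>free_dual_cat C J\<^esub>
          whisker_right C (edge_path (dual_graph C J) a) W)
        (whisker_right C (edge_path (dual_graph C J) a) X \<cdot>\<^bsub>free_dual_cat C J\<^esub>
          whisker_left C U (edge_path (dual_graph C J) b))"
  | triangle_obj: "dual_rel C J
        (whisker_right C (prim_path C J Counit) [J] \<cdot>\<^bsub>free_dual_cat C J\<^esub>
          whisker_left C [J] (prim_path C J Unit))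
        (Ident (free_dual_cat C J) [J])"
  | triangle_dual: "dual_rel C J
        (whisker_left C (dual_obj C) (prim_path C J Counit) \<cdot>\<^bsub>free_dual_cat C J\<^esub>
          whisker_right C (prim_path C J Unit) (dual_obj C))
        (Ident (free_dual_cat C J) (dual_obj C))"
  | whiskered: "dual_rel C J l l' \<Longrightarrow> Y \<in> seqs C \<Longrightarrow> Z \<in> seqs C \<Longrightarrow>
      dual_rel C J (whisker C Y l Z) (whisker C Y l' Z)"

definition dual_class ::
  "('o, 'm, 'z) monoidal_cat_scheme \<Rightarrow> 'o \<Rightarrow> ('o, 'm) edge_seq \<Rightarrow> ('o, 'm) edge_seq set" where
  "dual_class C J = cong_class (free_dual_cat C J) (dual_rel C J)"

definition path_tensor ::
  "('o, 'm, 'z) monoidal_cat_scheme \<Rightarrow> 'o \<Rightarrow>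
    ('o, 'm) edge_seq \<Rightarrow> ('o, 'm) edge_seq \<Rightarrow> ('o, 'm) edge_seq" where
  "path_tensor C J a b =
    whisker_left C (Cod (free_dual_cat C J) a) b \<cdot>\<^bsub>free_dual_cat C J\<^esub>
      whisker_right C a (Dom (free_dual_cat C J) b)"

definition adjoin_dual ::
  "('o, 'm, 'z) monoidal_cat_scheme \<Rightarrow> 'o \<Rightarrow> ('o list, ('o, 'm) edge_seq set) monoidal_cat" where
  "adjoin_dual C J =
    cat.extend (quotient_cat (free_dual_cat C J) (dual_rel C J))
      (monoidal_cat.fields
        (seq_tensor C)
        (\<lambda>A B. \<Union>a\<in>A. \<Union>b\<in>B. dual_class C J (path_tensor C J a b))
        (seq_unit C))"

definition dual_counit ::
  "('o, 'm, 'z) monoidal_cat_scheme \<Rightarrow> 'o \<Rightarrow> ('o, 'm) edge_seq set" where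
  "dual_counit C J = dual_class C J (prim_path C J Counit)"

definition dual_unit ::
  "('o, 'm, 'z) monoidal_cat_scheme \<Rightarrow> 'o \<Rightarrow> ('o, 'm) edge_seq set" where
  "dual_unit C J = dual_class C J (prim_path C J Unit)"

text \<open>The arrow part of the canonical functor from \<open>C\<close>; its object part is \<open>A \<mapsto> [A]\<close>.\<close>

definition incl_arr ::
  "('o, 'm, 'z) monoidal_cat_scheme \<Rightarrow> 'o \<Rightarrow> 'm \<Rightarrow> ('o, 'm) edge_seq set" where
  "incl_arr C J f = dual_class C J (prim_path C J (Bar f))"


text \<open>A functor from \<open>C\<^sup>o\<^sup>p \<times> C\<close> to sets is given by sets \<open>P A B\<close> (contravariant in \<open>A\<close>,
  covariant in \<open>B\<close>) and maps \<open>M h k : P (Cod h) (Dom k) \<rightarrow> P (Dom h) (Cod k)\<close>. Its coend is the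
  quotient of the disjoint union of the sets \<open>P Y Y\<close> by the equivalence relation generated by
  \<open>M h 1 x \<sim> M 1 h x\<close> for \<open>h : Y \<rightarrow> Y'\<close> and \<open>x \<in> P Y' Y\<close>.\<close>

definition coend_gen ::
  "('o, 'm, 'z) cat_scheme \<Rightarrow> ('o \<Rightarrow> 'o \<Rightarrow> 'x set) \<Rightarrow> ('m \<Rightarrow> 'm \<Rightarrow> 'x \<Rightarrow> 'x) \<Rightarrow> ('o \<times> 'x) rel" where
  "coend_gen C P M =
    {((Dom C h, M h (Ident C (Dom C h)) x), (Cod C h, M (Ident C (Cod C h)) h x)) | h x.
      h \<in> Arr C \<and> x \<in> P (Cod C h) (Dom C h)}"

definition coend_rel ::
  "('o, 'm, 'z) cat_scheme \<Rightarrow> ('o \<Rightarrow> 'o \<Rightarrow> 'x set) \<Rightarrow> ('m \<Rightarrow> 'm \<Rightarrow> 'x \<Rightarrow> 'x) \<Rightarrow> ('o \<times> 'x) rel" where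
  "coend_rel C P M = (coend_gen C P M \<union> (coend_gen C P M)\<inverse>)\<^sup>*"

definition coend ::
  "('o, 'm, 'z) cat_scheme \<Rightarrow> ('o \<Rightarrow> 'o \<Rightarrow> 'x set) \<Rightarrow> ('m \<Rightarrow> 'm \<Rightarrow> 'x \<Rightarrow> 'x) \<Rightarrow> ('o \<times> 'x) set set"
  where
  "coend C P M = (SIGMA Y:Obj C. P Y Y) // coend_rel C P M"

definition coend_class ::
  "('o, 'm, 'z) cat_scheme \<Rightarrow> ('o \<Rightarrow> 'o \<Rightarrow> 'x set) \<Rightarrow> ('m \<Rightarrow> 'm \<Rightarrow> 'x \<Rightarrow> 'x) \<Rightarrow>
    'o \<Rightarrow> 'x \<Rightarrow> ('o \<times> 'x) set"
  where
  "coend_class C P M Y x = coend_rel C P M `` {(Y, x)}"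


definition zeta_fun ::
  "('o, 'm, 'z) monoidal_cat_scheme \<Rightarrow> 'o \<Rightarrow> 'o \<Rightarrow> 'o list \<Rightarrow>
    'o \<Rightarrow> 'o \<Rightarrow> ('m \<times> ('o, 'm) edge_seq set) set" where
  "zeta_fun C J U0 V A B =
    Hom C U0 (hd V \<otimes>\<^sub>o\<^bsub>C\<^esub> B) \<times> Hom (adjoin_dual C J) [J \<otimes>\<^sub>o\<^bsub>C\<^esub> A] (tl V)"

definition zeta_fun_map ::
  "('o, 'm, 'z) monoidal_cat_scheme \<Rightarrow> 'o \<Rightarrow> 'o list \<Rightarrow>
    'm \<Rightarrow> 'm \<Rightarrow> 'm \<times> ('o, 'm) edge_seq set \<Rightarrow> 'm \<times> ('o, 'm) edge_seq set" where
  "zeta_fun_map C J V h k = (\<lambda>(f, g).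
    ((Ident C (hd V) \<otimes>\<^bsub>C\<^esub> k) \<cdot>\<^bsub>C\<^esub> f,
     g \<cdot>\<^bsub>adjoin_dual C J\<^esub> incl_arr C J (Ident C J \<otimes>\<^bsub>C\<^esub> h)))"

abbreviation zeta_dom ::
  "('o, 'm, 'z) monoidal_cat_scheme \<Rightarrow> 'o \<Rightarrow> 'o \<Rightarrow> 'o list \<Rightarrow>
    ('o \<times> 'm \<times> ('o, 'm) edge_seq set) set set" where
  "zeta_dom C J U0 V \<equiv> coend C (zeta_fun C J U0 V) (zeta_fun_map C J V)"

abbreviation zeta_class ::
  "('o, 'm, 'z) monoidal_cat_scheme \<Rightarrow> 'o \<Rightarrow> 'o \<Rightarrow> 'o list \<Rightarrow>
    'o \<Rightarrow> 'm \<Rightarrow> ('o, 'm) edge_seq set \<Rightarrow> ('o \<times> 'm \<times> ('o, 'm) edge_seq set) set" where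
  "zeta_class C J U0 V Y f g \<equiv> coend_class C (zeta_fun C J U0 V) (zeta_fun_map C J V) Y (f, g)"

definition zeta_composite ::
  "('o, 'm, 'z) monoidal_cat_scheme \<Rightarrow> 'o \<Rightarrow> 'o list \<Rightarrow>
    'o \<Rightarrow> 'm \<Rightarrow> ('o, 'm) edge_seq set \<Rightarrow> ('o, 'm) edge_seq set" where
  "zeta_composite C J V Y f g = (let D = adjoin_dual C J in
    (Ident D [hd V] \<otimes>\<^bsub>D\<^esub> Ident D (dual_obj C) \<otimes>\<^bsub>D\<^esub> g) \<cdot>\<^bsub>D\<^esub>
      ((Ident D [hd V] \<otimes>\<^bsub>D\<^esub> dual_unit C J \<otimes>\<^bsub>D\<^esub> Ident D [Y]) \<cdot>\<^bsub>D\<^esub> incl_arr C J f))"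

text \<open>\<open>zeta\<close> sends a class to the common value of the composite on its representatives.\<close>

definition zeta ::
  "('o, 'm, 'z) monoidal_cat_scheme \<Rightarrow> 'o \<Rightarrow> 'o list \<Rightarrow>
    ('o \<times> 'm \<times> ('o, 'm) edge_seq set) set \<Rightarrow> ('o, 'm) edge_seq set" where
  "zeta C J V c = the_elem ((\<lambda>(Y, f, g). zeta_composite C J V Y f g) ` c)"

end

theory Submission
  imports Defs
begin

text \<open>For a fixed object \<open>X\<close> of \<open>C\<close>, iterating the coend of the statement suggests that a morphism
  \<open>X \<rightarrow> (V\<^sub>0, \<dots>, V\<^sub>n)\<close> should be a chain \<open>f\<^sub>0 : X \<rightarrow> V\<^sub>0 \<otimes> Y\<^sub>1\<close>, \<open>f\<^sub>i : J \<otimes> Y\<^sub>i \<rightarrow> V\<^sub>i \<otimes> Y\<^sub>i\<^sub>+\<^sub>1\<close>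
  with \<open>Y\<^sub>n\<^sub>+\<^sub>1 = \<I>\<close>, taken modulo sliding morphisms \<open>Y\<^sub>i \<rightarrow> Y\<^sub>i'\<close> across \<open>J\<close>. The edges of the graph act
  on chains from \<open>X\<close>, and this action respects sliding and all defining relations of \<open>C[J\<^sup>\<or>]\<close>.
  Conversely a chain is read as the path \<open>f\<^sub>0\<close>, \<open>\<eta>\<close>, \<open>f\<^sub>1\<close>, \<open>\<eta>\<close>, and so on. Reading the result of a path
  acting on the identity chain returns the path, up to congruence, and acting on the identity chain
  by the path of a chain returns the chain, up to sliding. So morphisms \<open>[X] \<rightarrow> V\<close> are exactly chains
  modulo sliding; splitting off \<open>f\<^sub>0\<close> gives the coend description.\<close>

section \<open>Strict monoidal categories and sequences of objects\<close>

lemma Hom_iff: "f \<in> Hom C a b \<longleftrightarrow> f \<in> Arr C \<and> Dom C f = a \<and> Cod C f = b"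
  by (auto simp: Hom_def)

context category
begin

lemma Dom_Obj [simp]: "f \<in> Arr C \<Longrightarrow> Dom C f \<in> Obj C"
  by (rule Dom_closed)

lemma Cod_Obj [simp]: "f \<in> Arr C \<Longrightarrow> Cod C f \<in> Obj C"
  by (rule Cod_closed)

lemma Ident_simps [simp]:
  assumes "a \<in> Obj C"
  shows "Ident C a \<in> Arr C" "Dom C (Ident C a) = a" "Cod C (Ident C a) = a"
  using Ident_Hom[OF assms] by (auto simp: Hom_iff)

lemma Comp_simps [simp]:
  assumes "f \<in> Arr C" "g \<in> Arr C" "Dom C g = Cod C f"
  shows "g \<cdot> f \<in> Arr C" "Dom C (g \<cdot> f) = Dom C f" "Cod C (g \<cdot> f) = Cod C g"
  using Comp_Hom[of f "Dom C f" "Cod C f" g "Cod C g"] assms by (auto simp: Hom_iff)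

lemma Comp_assoc_simp [simp]:
  assumes "f \<in> Arr C" "g \<in> Arr C" "h \<in> Arr C" "Dom C g = Cod C f" "Dom C h = Cod C g"
  shows "h \<cdot> (g \<cdot> f) = h \<cdot> g \<cdot> f"
  using assms by (intro Comp_assoc) (auto simp: Hom_iff)

lemma Comp_Ident_simps [simp]:
  "f \<in> Arr C \<Longrightarrow> Cod C f = b \<Longrightarrow> Ident C b \<cdot> f = f"
  "f \<in> Arr C \<Longrightarrow> Dom C f = a \<Longrightarrow> f \<cdot> Ident C a = f"
  using Comp_Ident_left Comp_Ident_right by (auto simp: Hom_iff)

end

context strict_monoidal_category
begin

lemma unit_Obj [simp]: "\<I> \<in> Obj C"
  by (rule unit_closed)

lemma tensor_Obj [simp]: "a \<in> Obj C \<Longrightarrow> b \<in> Obj C \<Longrightarrow> a \<otimes>\<^sub>o b \<in> Obj C"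
  by (rule tensor_obj_closed)

lemma tensor_arr_simps [simp]:
  assumes "f \<in> Arr C" "g \<in> Arr C"
  shows "f \<otimes> g \<in> Arr C" "Dom C (f \<otimes> g) = Dom C f \<otimes>\<^sub>o Dom C g"
    "Cod C (f \<otimes> g) = Cod C f \<otimes>\<^sub>o Cod C g"
  using tensor_arr_Hom[of f "Dom C f" "Cod C f" g "Dom C g" "Cod C g"] assms by (auto simp: Hom_iff)

declare tensor_obj_assoc [simp] tensor_arr_assoc [simp] tensor_Ident [simp]
  unit_tensor_obj [simp] tensor_unit_obj [simp] unit_tensor_arr [simp] tensor_unit_arr [simp]

lemma tensor_Ident_Ident [simp]:
  assumes "f \<in> Arr C" "a \<in> Obj C" "b \<in> Obj C"
  shows "f \<otimes> Ident C a \<otimes> Ident C b = f \<otimes> Ident C (a \<otimes>\<^sub>o b)"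
  using assms tensor_arr_assoc[of f "Ident C a" "Ident C b"] by (simp del: tensor_arr_assoc)

lemma interchange_law:
  assumes "f \<in> Arr C" "f' \<in> Arr C" "g \<in> Arr C" "g' \<in> Arr C" "Dom C f' = Cod C f"
      "Dom C g' = Cod C g"
  shows "(f' \<otimes> g') \<cdot> (f \<otimes> g) = (f' \<cdot> f) \<otimes> (g' \<cdot> g)"
  using assms by (intro tensor_Comp[symmetric]) (auto simp: Hom_iff)

lemma whisker_Comp:
  assumes "a \<in> Obj C" "f \<in> Arr C" "g \<in> Arr C" "Dom C g = Cod C f"
  shows "Ident C a \<otimes> (g \<cdot> f) = (Ident C a \<otimes> g) \<cdot> (Ident C a \<otimes> f)"
  using assms by (subst interchange_law) auto

text \<open>Both sides are \<open>f \<otimes> g\<close>; this lets a morphism on one tensor factor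
  pass a morphism on the other.\<close>

lemma middle_four:
  assumes "f \<in> Arr C" "g \<in> Arr C"
  shows "(Ident C (Cod C f) \<otimes> g) \<cdot> (f \<otimes> Ident C (Dom C g)) =
    (f \<otimes> Ident C (Cod C g)) \<cdot> (Ident C (Dom C f) \<otimes> g)"
  using assms by (simp add: interchange_law)

lemma middle_four_whisker:
  assumes "a \<in> Obj C" "f \<in> Arr C" "m \<in> Obj C" "g \<in> Arr C"
  shows "(Ident C (a \<otimes>\<^sub>o Cod C f \<otimes>\<^sub>o m) \<otimes> g) \<cdot> (Ident C a \<otimes> f \<otimes> Ident C (m \<otimes>\<^sub>o Dom C g)) =
    (Ident C a \<otimes> f \<otimes> Ident C (m \<otimes>\<^sub>o Cod C g)) \<cdot> (Ident C (a \<otimes>\<^sub>o Dom C f \<otimes>\<^sub>o m) \<otimes> g)"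
  using middle_four[of "Ident C a \<otimes> f \<otimes> Ident C m" g] assms by simp

lemma whisker_Comp_both:
  assumes "a \<in> Obj C" "b \<in> Obj C" "f \<in> Arr C" "g \<in> Arr C" "Dom C g = Cod C f"
  shows "Ident C a \<otimes> (g \<cdot> f) \<otimes> Ident C b =
    (Ident C a \<otimes> g \<otimes> Ident C b) \<cdot> (Ident C a \<otimes> f \<otimes> Ident C b)"
  using assms by (simp add: interchange_law)

section \<open>The monoid of nonempty sequences of objects\<close>

lemma seqs_Cons [simp]: "A # V \<in> seqs C \<longleftrightarrow> A \<in> Obj C \<and> (V = [] \<or> V \<in> seqs C)"
  by (auto simp: seqs_def)

lemma seqs_append [simp]:
  "U \<noteq> [] \<Longrightarrow> V \<noteq> [] \<Longrightarrow> U @ V \<in> seqs C \<longleftrightarrow> U \<in> seqs C \<and> V \<in> seqs C"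
  by (auto simp: seqs_def)

lemma seqs_not_Nil [simp]: "[] \<notin> seqs C"
  by (auto simp: seqs_def)

lemma seqs_neq_Nil: "U \<in> seqs C \<Longrightarrow> U \<noteq> []"
  by (auto simp: seqs_def)

lemma seq_tensor_single [simp]: "[A] \<odot> (B # V) = (A \<otimes>\<^sub>o B) # V"
  by (simp add: seq_tensor_def)

lemma seq_tensor_Cons [simp]: "(A # A' # U) \<odot> V = A # ((A' # U) \<odot> V)"
  by (simp add: seq_tensor_def)

lemma seq_tensor_Cons': "U \<noteq> [] \<Longrightarrow> (A # U) \<odot> V = A # (U \<odot> V)"
  by (simp add: seq_tensor_def)

lemma seq_tensor_neq_Nil [simp]: "U \<odot> V \<noteq> []"
  by (simp add: seq_tensor_def)

lemma seq_tensor_seqs [simp]: "U \<in> seqs C \<Longrightarrow> V \<in> seqs C \<Longrightarrow> U \<odot> V \<in> seqs C"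
proof (induction U)
  case (Cons A U)
  then show ?case by (cases U; cases V) (auto simp: seqs_def)
qed auto

text \<open>The rewrite direction is opposite to that for objects: sequences associate to the right,
  so that leading entries are exposed to recursions on the left factor.\<close>

lemma seq_tensor_assoc [simp]:
  "U \<in> seqs C \<Longrightarrow> V \<in> seqs C \<Longrightarrow> W \<in> seqs C \<Longrightarrow> U \<odot> V \<odot> W = U \<odot> (V \<odot> W)"
proof (induction U)
  case (Cons A U)
  show ?case
  proof (cases U)
    case Nil
    obtain B V' where V: "V = B # V'" using Cons.prems by (cases V) auto
    obtain D W' where W: "W = D # W'" using Cons.prems by (cases W) auto
    show ?thesis using Cons.prems Nil V W
      by (cases V') (auto simp: seq_tensor_Cons')
  next
    case (Cons B U')
    then show ?thesis using Cons.IH Cons.prems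
      by (auto simp: seq_tensor_Cons')
  qed
qed auto

lemma seq_unit_seqs [simp]: "seq_unit C \<in> seqs C" "dual_obj C \<in> seqs C"
  by (auto simp: seq_unit_def dual_obj_def)

lemma seq_unit_left [simp]: "U \<in> seqs C \<Longrightarrow> [\<I>] \<odot> U = U"
  by (cases U) auto

lemma seq_unit_right [simp]: "U \<in> seqs C \<Longrightarrow> U \<odot> [\<I>] = U"
proof (induction U)
  case (Cons A U)
  then show ?case by (cases U) auto
qed auto

end

section \<open>Chains and the action of edges\<close>

locale dual_adjunction = strict_monoidal_category C
  for C :: "('o, 'm) monoidal_cat" (structure) and J :: 'o +
  assumes J_Obj [simp]: "J \<in> Obj C"
begin

abbreviation src where "src \<equiv> prim_src C J"
abbreviation tgt where "tgt \<equiv> prim_tgt C J"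

definition prims :: "'m prim_edge set" where
  "prims = {Counit, Unit} \<union> Bar ` Arr C"

lemma prims_iff [simp]: "Counit \<in> prims" "Unit \<in> prims" "Bar f \<in> prims \<longleftrightarrow> f \<in> Arr C"
  by (auto simp: prims_def)

lemma src_tgt_simps [simp]: "src Counit = [J, \<I>]" "src Unit = [\<I>]" "tgt Counit = [\<I>]"
    "tgt Unit = [\<I>, J]"
  by (auto simp: dual_obj_def seq_unit_def)

declare prim_src.simps(1,2) [simp del] prim_tgt.simps(1,2) [simp del]

lemma prim_seqs [simp]: "p \<in> prims \<Longrightarrow> src p \<in> seqs C" "p \<in> prims \<Longrightarrow> tgt p \<in> seqs C"
  by (cases p; auto)+

text \<open>The entry \<open>(g, Y)\<close> stands for \<open>g\<close> with codomain \<open>A \<otimes> Y\<close>; \<open>Y\<close> is recorded since it cannot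
  be recovered from \<open>g\<close>.\<close>

fun chain :: "'o \<Rightarrow> 'o list \<Rightarrow> ('m \<times> 'o) list \<Rightarrow> bool" where
  "chain X (A # V) ((g, Y) # cs) \<longleftrightarrow> g \<in> Arr C \<and> Dom C g = X \<and> Cod C g = A \<otimes>\<^sub>o Y \<and>
     A \<in> Obj C \<and> Y \<in> Obj C \<and>
     (if V = [] then Y = \<I> \<and> cs = [] else chain (J \<otimes>\<^sub>o Y) V cs)"
| "chain _ _ _ \<longleftrightarrow> False"

text \<open>The source of a chain enters only its first morphism, so restriction along
  \<open>k\<close> changes nothing else.\<close>

fun precomp :: "'m \<Rightarrow> ('m \<times> 'o) list \<Rightarrow> ('m \<times> 'o) list" where
  "precomp k ((g, Y) # cs) = (g \<cdot> k, Y) # cs"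
| "precomp k [] = []"

text \<open>The chain form of the coend relation: \<open>slide\<close> moves \<open>k\<close> across
  the \<open>J\<close> after the first entry, and \<open>Cons\<close> lets this happen at any later
  \<open>J\<close>. Reflexivity asks for a chain, so related lists are always well typed.\<close>

inductive chain_eq :: "'o \<Rightarrow> 'o list \<Rightarrow> ('m \<times> 'o) list \<Rightarrow> ('m \<times> 'o) list \<Rightarrow> bool" where
  slide: "g \<in> Hom C X (A \<otimes>\<^sub>o Y) \<Longrightarrow> A \<in> Obj C \<Longrightarrow> k \<in> Hom C Y Y' \<Longrightarrow> chain (J \<otimes>\<^sub>o Y') V cs \<Longrightarrow>
    chain_eq X (A # V) (((Ident C A \<otimes> k) \<cdot> g, Y') # cs) ((g, Y) # precomp (Ident C J \<otimes> k) cs)"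
| Cons: "g \<in> Hom C X (A \<otimes>\<^sub>o Y) \<Longrightarrow> A \<in> Obj C \<Longrightarrow> Y \<in> Obj C \<Longrightarrow> chain_eq (J \<otimes>\<^sub>o Y) V cs cs' \<Longrightarrow>
    chain_eq X (A # V) ((g, Y) # cs) ((g, Y) # cs')"
| refl: "chain X V cs \<Longrightarrow> chain_eq X V cs cs"
| sym: "chain_eq X V cs cs' \<Longrightarrow> chain_eq X V cs' cs"
| trans: "chain_eq X V cs cs' \<Longrightarrow> chain_eq X V cs' cs'' \<Longrightarrow> chain_eq X V cs cs''"

fun merge :: "'o \<Rightarrow> 'm \<Rightarrow> ('m \<times> 'o) list \<Rightarrow> ('m \<times> 'o) list" where
  "merge A g ((h, Y) # cs) = ((Ident C A \<otimes> h) \<cdot> g, Y) # cs"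
| "merge A g [] = []"

text \<open>The edges are whiskered by \<open>A\<close> on the left and \<open>B\<close> on the right within the entry they touch.
  The unit splits an entry in two without changing its morphism; the counit composes the two entries
  on either side of the \<open>J\<close> that it cancels.\<close>

fun prim_act :: "'o \<Rightarrow> 'm prim_edge \<Rightarrow> 'o \<Rightarrow> ('m \<times> 'o) list \<Rightarrow> ('m \<times> 'o) list" where
  "prim_act A (Bar f) B ((g, Y) # cs) = ((Ident C A \<otimes> f \<otimes> Ident C (B \<otimes>\<^sub>o Y)) \<cdot> g, Y) # cs"
| "prim_act A Counit B ((g, Y) # cs) = merge A g cs"
| "prim_act A Unit B ((g, Y) # cs) = (g, B \<otimes>\<^sub>o Y) # (Ident C (J \<otimes>\<^sub>o B \<otimes>\<^sub>o Y), Y) # cs"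
| "prim_act A p B cs = cs"

text \<open>The length of \<open>L\<close> encodes the position of the touched entry: the last entry
  of \<open>L\<close> and the head of \<open>R\<close> are fused with the ends of \<open>p\<close>,
  and the links before that entry are copied.\<close>

fun act :: "'o list \<Rightarrow> 'm prim_edge \<Rightarrow> 'o list \<Rightarrow> ('m \<times> 'o) list \<Rightarrow> ('m \<times> 'o) list" where
  "act [A] p R cs = prim_act A p (hd R) cs"
| "act (A # A' # L) p R cs = hd cs # act (A' # L) p R (tl cs)"
| "act [] p R cs = cs"

section \<open>Typing of chains and of the action\<close>

lemma chain_nonempty [simp]: "\<not> chain X V []" "\<not> chain X [] cs"
  by (cases V; cases cs; auto)+

lemma chain_Obj: "chain X V cs \<Longrightarrow> X \<in> Obj C"
  by (cases "(X, V, cs)" rule: chain.cases) auto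

lemma chain_seqs: "chain X V cs \<Longrightarrow> V \<in> seqs C"
  by (induction X V cs rule: chain.induct) (auto split: if_splits)

lemma chain_ConsE:
  assumes "chain X (A # V) cs"
  obtains g Y cs' where "cs = (g, Y) # cs'" "g \<in> Arr C" "Dom C g = X" "Cod C g = A \<otimes>\<^sub>o Y"
    "A \<in> Obj C" "Y \<in> Obj C" "if V = [] then Y = \<I> \<and> cs' = [] else chain (J \<otimes>\<^sub>o Y) V cs'"
  using assms by (cases cs) auto

lemma chain_precomp: "chain X V cs \<Longrightarrow> k \<in> Hom C X' X \<Longrightarrow> chain X' V (precomp k cs)"
  by (cases "(X, V, cs)" rule: chain.cases) (auto simp: Hom_iff)

lemma chain_eq_chain: "chain_eq X V cs cs' \<Longrightarrow> chain X V cs \<and> chain X V cs'"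
proof (induction rule: chain_eq.induct)
  case (slide g X A Y k Y' V cs)
  then have "chain (J \<otimes>\<^sub>o Y) V (precomp (Ident C J \<otimes> k) cs)"
    by (intro chain_precomp) (auto simp: Hom_iff)
  with slide show ?case by (cases "V = []") (auto simp: Hom_iff)
next
  case (Cons g X A Y V cs cs')
  then show ?case by (cases "V = []") (auto simp: Hom_iff)
qed auto

lemma prim_act_chain:
  assumes "chain X ([A] \<odot> (src p \<odot> (B # R))) cs" "A \<in> Obj C" "B # R \<in> seqs C" "p \<in> prims"
  shows "chain X ([A] \<odot> (tgt p \<odot> (B # R))) (prim_act A p B cs)"
proof (cases p)
  case Counit
  then show ?thesis using assms by (auto elim!: chain_ConsE)
next
  case Unit
  then show ?thesis using assms by (auto elim!: chain_ConsE)
next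
  case (Bar f)
  then show ?thesis using assms by (auto elim!: chain_ConsE)
qed

lemma act_chain:
  assumes "chain X (L \<odot> (src p \<odot> R)) cs" "L \<in> seqs C" "R \<in> seqs C" "p \<in> prims"
  shows "chain X (L \<odot> (tgt p \<odot> R)) (act L p R cs)"
  using assms
proof (induction L p R cs arbitrary: X rule: act.induct)
  case (1 A p R cs)
  obtain B R' where "R = B # R'" using 1 by (cases R) auto
  then show ?case using prim_act_chain[of X A p B R' cs] 1 by simp
next
  case (2 A A' L p R cs)
  then show ?case by (auto elim!: chain_ConsE)
qed auto

lemma act_single [simp]: "act [A] p (B # R) cs = prim_act A p B cs"
  by simp

lemma act_Cons: "L \<noteq> [] \<Longrightarrow> act (A # L) p R (c # cs) = c # act L p R cs"
  by (cases L) auto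

text \<open>An edge only composes after the first morphism or leaves it alone, so by associativity
  it commutes with a change of source. This carries a slide past an edge that acts later in the
  chain.\<close>

lemma act_precomp:
  assumes "chain X (L \<odot> (src p \<odot> R)) cs" "k \<in> Hom C X' X" "L \<in> seqs C" "R \<in> seqs C" "p \<in> prims"
  shows "act L p R (precomp k cs) = precomp k (act L p R cs)"
proof -
  obtain A L' where L: "L = A # L'" using assms by (cases L) auto
  obtain B R' where R: "R = B # R'" using assms by (cases R) auto
  show ?thesis
  proof (cases L')
    case Nil
    then show ?thesis using assms L R
      by (cases p) (auto elim!: chain_ConsE simp: Hom_iff)
  next
    case (Cons A' L'')
    then show ?thesis using assms L by (auto elim!: chain_ConsE)
  qed
qed

section \<open>Invariance of the action under sliding\<close>

text \<open>Serves the counit, which removes the first joint of a chain: a slide at the next joint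
  is again a slide once \<open>g\<close> is absorbed into the morphism, and later changes are not
  affected. \<open>W\<close> is a variable for the sake of the induction.\<close>

lemma merge_chain_eq:
  assumes "chain_eq X W cs cs'" "W = B # R" "g \<in> Hom C Z (A \<otimes>\<^sub>o X)" "A \<in> Obj C"
  shows "chain_eq Z ((A \<otimes>\<^sub>o B) # R) (merge A g cs) (merge A g cs')"
  using assms
proof (induction rule: chain_eq.induct)
  case (slide g' X A' Y k Y' V cs)
  have "chain_eq Z ((A \<otimes>\<^sub>o B) # R) (((Ident C (A \<otimes>\<^sub>o B) \<otimes> k) \<cdot> ((Ident C A \<otimes> g') \<cdot> g), Y') # cs)
    (((Ident C A \<otimes> g') \<cdot> g, Y) # precomp (Ident C J \<otimes> k) cs)"
    using slide by (intro chain_eq.slide) (auto simp: Hom_iff)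
  then show ?case using slide by (auto simp: Hom_iff whisker_Comp)
next
  case (Cons g' X A' Y V cs cs')
  then show ?case by (auto simp: Hom_iff intro: chain_eq.Cons)
next
  case (refl X V cs)
  then show ?case by (auto elim!: chain_ConsE simp: Hom_iff intro!: chain_eq.refl)
qed (blast intro: chain_eq.sym chain_eq.trans)+

text \<open>A slide at the entry where the edge acts. For the counit it crosses the very
  \<open>J\<close> being cancelled, and both sides become equal; for a bar, \<open>k\<close> and
  \<open>f\<close> act on different tensor factors and commute.\<close>

lemma prim_act_slide:
  assumes "g \<in> Hom C X (A' \<otimes>\<^sub>o Y)" "A' \<in> Obj C" "k \<in> Hom C Y Y'" "chain (J \<otimes>\<^sub>o Y') V cs"
    and V: "A' # V = [A] \<odot> (src p \<odot> (B # R))" and "A \<in> Obj C" "B # R \<in> seqs C" "p \<in> prims"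
  shows "chain_eq X ([A] \<odot> (tgt p \<odot> (B # R))) (prim_act A p B (((Ident C A' \<otimes> k) \<cdot> g, Y') # cs))
    (prim_act A p B ((g, Y) # precomp (Ident C J \<otimes> k) cs))"
proof (cases p)
  case Counit
  then show ?thesis using assms
    by (auto elim!: chain_ConsE simp: Hom_iff whisker_Comp intro!: chain_eq.refl)
next
  case Unit
  \<comment> \<open>The unit has inserted a new \<open>J\<close> before \<open>B\<close>, so two
    slides are needed: first \<open>B \<otimes> k\<close> crosses the new \<open>J\<close>, then
    \<open>k\<close> crosses the old one, passing the identity entry in between.\<close>
  have 1: "chain_eq X (A # (J \<otimes>\<^sub>o B) # R)
      (((Ident C A \<otimes> (Ident C B \<otimes> k)) \<cdot> g, B \<otimes>\<^sub>o Y') # (Ident C (J \<otimes>\<^sub>o B \<otimes>\<^sub>o Y'), Y') # cs)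
      ((g, B \<otimes>\<^sub>o Y) # precomp (Ident C J \<otimes> (Ident C B \<otimes> k)) ((Ident C (J \<otimes>\<^sub>o B \<otimes>\<^sub>o Y'), Y') # cs))"
    using assms Unit by (intro chain_eq.slide) (auto simp: Hom_iff)
  have 2: "chain_eq X (A # (J \<otimes>\<^sub>o B) # R)
      ((g, B \<otimes>\<^sub>o Y) # ((Ident C (J \<otimes>\<^sub>o B) \<otimes> k) \<cdot> Ident C (J \<otimes>\<^sub>o B \<otimes>\<^sub>o Y), Y') # cs)
      ((g, B \<otimes>\<^sub>o Y) # (Ident C (J \<otimes>\<^sub>o B \<otimes>\<^sub>o Y), Y) # precomp (Ident C J \<otimes> k) cs)"
    using assms Unit by (intro chain_eq.Cons chain_eq.slide) (auto simp: Hom_iff)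
  show ?thesis using chain_eq.trans[OF 1] 2 assms Unit by (auto simp: Hom_iff)
next
  case (Bar f)
  have "chain_eq X ((A \<otimes>\<^sub>o Cod C f \<otimes>\<^sub>o B) # R)
      (((Ident C (A \<otimes>\<^sub>o Cod C f \<otimes>\<^sub>o B) \<otimes> k) \<cdot> ((Ident C A \<otimes> f \<otimes> Ident C (B \<otimes>\<^sub>o Y)) \<cdot> g), Y') # cs)
      (((Ident C A \<otimes> f \<otimes> Ident C (B \<otimes>\<^sub>o Y)) \<cdot> g, Y) # precomp (Ident C J \<otimes> k) cs)"
    using assms Bar by (intro chain_eq.slide) (auto simp: Hom_iff)
  then show ?thesis using assms Bar middle_four_whisker[of A f B k] by (auto simp: Hom_iff)
qed

lemma prim_act_chain_eq_Cons:
  assumes "g \<in> Hom C X (A' \<otimes>\<^sub>o Y)" "A' \<in> Obj C" "Y \<in> Obj C" "chain_eq (J \<otimes>\<^sub>o Y) V cs cs'"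
    and V: "A' # V = [A] \<odot> (src p \<odot> (B # R))" and "A \<in> Obj C" "B # R \<in> seqs C" "p \<in> prims"
  shows "chain_eq X ([A] \<odot> (tgt p \<odot> (B # R))) (prim_act A p B ((g, Y) # cs))
    (prim_act A p B ((g, Y) # cs'))"
proof (cases p)
  case Counit
  then show ?thesis using assms merge_chain_eq[OF assms(4), of B R g X A]
    by auto
next
  case Unit
  then show ?thesis using assms by (auto simp: Hom_iff intro!: chain_eq.Cons)
next
  case (Bar f)
  then show ?thesis using assms by (auto simp: Hom_iff intro!: chain_eq.Cons)
qed

text \<open>If the edge acts beyond the first entry, a slide there survives because the edge
  commutes with \<open>precomp\<close>, and a change in the tail is handled by induction. At the
  first entry the two lemmas on \<open>prim_act\<close> apply.\<close>

lemma act_chain_eq: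
  assumes "chain_eq X V cs cs'" "V = L \<odot> (src p \<odot> R)" "L \<in> seqs C" "R \<in> seqs C" "p \<in> prims"
  shows "chain_eq X (L \<odot> (tgt p \<odot> R)) (act L p R cs) (act L p R cs')"
  using assms
proof (induction arbitrary: L rule: chain_eq.induct)
  case (slide g X A' Y k Y' V cs)
  obtain A L' where L: "L = A # L'" using slide by (cases L) auto
  obtain B R' where R: "R = B # R'" using slide by (cases R) auto
  show ?case
  proof (cases "L' = []")
    case True
    then show ?thesis using slide L R prim_act_slide[of g X A' Y k Y' V cs A p B R'] by simp
  next
    case False
    then have V: "A' = A" "V = L' \<odot> (src p \<odot> R)" using slide L by (auto simp: seq_tensor_Cons')
    then have "act L' p R (precomp (Ident C J \<otimes> k) cs) = precomp (Ident C J \<otimes> k) (act L' p R cs)"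
      using slide L False by (intro act_precomp[of "J \<otimes>\<^sub>o Y'"]) (auto simp: Hom_iff)
    then show ?thesis using slide L V False
      by (auto simp: seq_tensor_Cons' act_Cons intro!: chain_eq.slide act_chain)
  qed
next
  case (Cons g X A' Y V cs cs')
  obtain A L' where L: "L = A # L'" using Cons by (cases L) auto
  obtain B R' where R: "R = B # R'" using Cons by (cases R) auto
  show ?case
  proof (cases "L' = []")
    case True
    then show ?thesis using Cons L R prim_act_chain_eq_Cons[of g X A' Y V cs cs' A p B R'] by simp
  next
    case False
    then show ?thesis using Cons L by (auto simp: seq_tensor_Cons' act_Cons intro!: chain_eq.Cons)
  qed
next
  case (refl X V cs)
  then show ?case using act_chain chain_eq.refl by blast
qed (blast intro: chain_eq.sym chain_eq.trans)+

section \<open>Interchange of two edges on a chain\<close>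

text \<open>The middle sequence is a single object, so the edges meet in a common entry. Both orders
  give the same chain, except when \<open>p\<close> is the unit and \<open>q\<close> a counit or a
  bar: then the morphism brought in by \<open>q\<close> lands after the new \<open>J\<close> in one
  order and before it in the other, which is one slide.\<close>

lemma prim_act_interchange:
  assumes "chain X ([A] \<odot> (src p \<odot> ([m] \<odot> (src q \<odot> (B # R))))) cs"
    "A \<in> Obj C" "m \<in> Obj C" "B # R \<in> seqs C" "p \<in> prims" "q \<in> prims"
  shows "chain_eq X ([A] \<odot> (tgt p \<odot> ([m] \<odot> (tgt q \<odot> (B # R)))))
    (act ([A] \<odot> (tgt p \<odot> [m])) q (B # R) (act [A] p ([m] \<odot> (src q \<odot> (B # R))) cs))
    (act [A] p ([m] \<odot> (tgt q \<odot> (B # R))) (act ([A] \<odot> (src p \<odot> [m])) q (B # R) cs))"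
    (is "chain_eq X ?V ?lhs ?rhs")
proof -
  have typed: "chain X ?V ?rhs"
    using assms act_chain[of X "[A] \<odot> (src p \<odot> [m])" q "B # R" cs] by (intro act_chain) auto
  show ?thesis
  proof (cases p)
    case Counit
    have "?lhs = ?rhs"
      using assms Counit
      by (cases q) (auto elim!: chain_ConsE simp: Hom_iff whisker_Comp)
    with typed show ?thesis by (simp add: chain_eq.refl)
  next
    case (Bar f)
    have "?lhs = ?rhs"
    proof (cases q)
      case Counit
      with assms Bar obtain g Y h Y' cs' where cs: "cs = (g, Y) # (h, Y') # cs'"
        by (auto elim!: chain_ConsE)
      show ?thesis using assms Bar Counit cs middle_four_whisker[of A f m h] by auto
    next
      case Unit
      then show ?thesis using assms Bar by (auto elim!: chain_ConsE simp: Hom_iff)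
    next
      case q: (Bar h)
      with assms Bar obtain g Y cs' where cs: "cs = (g, Y) # cs'"
        by (auto elim!: chain_ConsE)
      show ?thesis using assms Bar q cs middle_four_whisker[of A f m "h \<otimes> Ident C (B \<otimes>\<^sub>o Y)"]
        by auto
    qed
    with typed show ?thesis by (simp add: chain_eq.refl)
  next
    case Unit
    show ?thesis
    proof (cases q)
      case Counit
      with assms Unit obtain g Y h Y' cs' where cs: "cs = (g, Y) # (h, Y') # cs'"
        by (auto elim!: chain_ConsE)
      have "chain_eq X (A # (J \<otimes>\<^sub>o m \<otimes>\<^sub>o B) # R)
          ((g, m \<otimes>\<^sub>o J \<otimes>\<^sub>o Y) # precomp (Ident C J \<otimes> (Ident C m \<otimes> h))
            ((Ident C (J \<otimes>\<^sub>o m \<otimes>\<^sub>o B \<otimes>\<^sub>o Y'), Y') # cs'))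
          (((Ident C A \<otimes> (Ident C m \<otimes> h)) \<cdot> g, m \<otimes>\<^sub>o B \<otimes>\<^sub>o Y') #
            (Ident C (J \<otimes>\<^sub>o m \<otimes>\<^sub>o B \<otimes>\<^sub>o Y'), Y') # cs')"
        using assms Unit Counit cs by (intro chain_eq.sym[OF chain_eq.slide]) (auto simp: Hom_iff)
      then show ?thesis using assms Unit Counit cs by auto
    next
      case q: Unit
      then have "?lhs = ?rhs" using assms Unit by (auto elim!: chain_ConsE simp: Hom_iff)
      with typed show ?thesis by (simp add: chain_eq.refl)
    next
      case (Bar h)
      with assms Unit obtain g Y cs' where cs: "cs = (g, Y) # cs'"
        by (auto elim!: chain_ConsE)
      let ?k = "Ident C m \<otimes> h \<otimes> Ident C (B \<otimes>\<^sub>o Y)"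
      have "chain_eq X (A # (J \<otimes>\<^sub>o m \<otimes>\<^sub>o Cod C h \<otimes>\<^sub>o B) # R)
          ((g, m \<otimes>\<^sub>o Dom C h \<otimes>\<^sub>o B \<otimes>\<^sub>o Y) # precomp (Ident C J \<otimes> ?k)
            ((Ident C (J \<otimes>\<^sub>o m \<otimes>\<^sub>o Cod C h \<otimes>\<^sub>o B \<otimes>\<^sub>o Y), Y) # cs'))
          (((Ident C A \<otimes> ?k) \<cdot> g, m \<otimes>\<^sub>o Cod C h \<otimes>\<^sub>o B \<otimes>\<^sub>o Y) #
            (Ident C (J \<otimes>\<^sub>o m \<otimes>\<^sub>o Cod C h \<otimes>\<^sub>o B \<otimes>\<^sub>o Y), Y) # cs')"
        using assms Unit Bar cs by (intro chain_eq.sym[OF chain_eq.slide]) (auto simp: Hom_iff)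
      then show ?thesis using assms Unit Bar cs by auto
    qed
  qed
qed

text \<open>Common leading entries are stripped by induction. When \<open>M\<close> has at least two
  entries, the edges touch disjoint entries and commute exactly; a one-entry \<open>M\<close> is the
  preceding lemma.\<close>

lemma act_interchange:
  assumes "chain X (L \<odot> (src p \<odot> (M \<odot> (src q \<odot> R)))) cs" "L \<in> seqs C" "M \<in> seqs C" "R \<in> seqs C"
    "p \<in> prims" "q \<in> prims"
  shows "chain_eq X (L \<odot> (tgt p \<odot> (M \<odot> (tgt q \<odot> R))))
    (act (L \<odot> (tgt p \<odot> M)) q R (act L p (M \<odot> (src q \<odot> R)) cs))
    (act L p (M \<odot> (tgt q \<odot> R)) (act (L \<odot> (src p \<odot> M)) q R cs))"
  using assms
proof (induction L arbitrary: X cs)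
  case (Cons A L)
  obtain m M' where M: "M = m # M'" using Cons by (cases M) auto
  obtain B R' where R: "R = B # R'" using Cons by (cases R) auto
  show ?case
  proof (cases "L = []")
    case False
    then show ?thesis using Cons.prems
      by (auto simp: seq_tensor_Cons' act_Cons Hom_iff elim!: chain_ConsE intro!: chain_eq.Cons
          Cons.IH)
  next
    case L: True
    show ?thesis
    proof (cases "M' = []")
      case False
      then have "act (([A] \<odot> (tgt p \<odot> M))) q R (act [A] p (M \<odot> (src q \<odot> R)) cs) =
          act [A] p (M \<odot> (tgt q \<odot> R)) (act ([A] \<odot> (src p \<odot> M)) q R cs)"
        using Cons.prems M R L
        by (cases p) (auto simp: seq_tensor_Cons' act_Cons Hom_iff elim!: chain_ConsE)
      moreover have "chain X ([A] \<odot> (tgt p \<odot> (M \<odot> (tgt q \<odot> R))))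
          (act [A] p (M \<odot> (tgt q \<odot> R)) (act ([A] \<odot> (src p \<odot> M)) q R cs))"
        using Cons.prems L act_chain[of X "[A] \<odot> (src p \<odot> M)" q R cs] by (intro act_chain) auto
      ultimately show ?thesis using L by (auto intro: chain_eq.refl)
    next
      case True
      then show ?thesis using Cons.prems L M R prim_act_interchange[of X A p m q B R' cs] by simp
    qed
  qed
qed auto

section \<open>Paths and soundness of the action\<close>

abbreviation F where "F \<equiv> free_dual_cat C J"

text \<open>Walks of \<open>dual_graph C J\<close> in recursive form, with endpoints written in the
  right-nested normal form of \<open>\<odot>\<close>.\<close>

fun path :: "'o list \<Rightarrow> ('o, 'm) edge list \<Rightarrow> 'o list \<Rightarrow> bool" where
  "path u [] v \<longleftrightarrow> u = v \<and> u \<in> seqs C"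
| "path u ((L, p, R) # es) v \<longleftrightarrow> L \<in> seqs C \<and> p \<in> prims \<and> R \<in> seqs C \<and>
     u = L \<odot> (src p \<odot> R) \<and> path (L \<odot> (tgt p \<odot> R)) es v"

lemma path_seqs: "path u es v \<Longrightarrow> u \<in> seqs C" "path u es v \<Longrightarrow> v \<in> seqs C"
  by (induction u es v rule: path.induct) auto

lemma dual_graph_simps:
  "verts (dual_graph C J) = seqs C"
  "arcs (dual_graph C J) = seqs C \<times> prims \<times> seqs C"
  "tail (dual_graph C J) (L, p, R) = L \<odot> src p \<odot> R"
  "head (dual_graph C J) (L, p, R) = L \<odot> tgt p \<odot> R"
  by (auto simp: dual_graph_def prims_def)

lemma awalk_iff_path: "pre_digraph.awalk (dual_graph C J) u es v \<longleftrightarrow> path u es v"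
proof (induction es arbitrary: u)
  case Nil
  then show ?case by (auto simp: pre_digraph.awalk_def pre_digraph.cas.simps dual_graph_simps)
next
  case (Cons e es)
  obtain L p R where e: "e = (L, p, R)" by (cases e) auto
  have "pre_digraph.awalk (dual_graph C J) u (e # es) v \<longleftrightarrow>
      L \<in> seqs C \<and> p \<in> prims \<and> R \<in> seqs C \<and> u = L \<odot> (src p \<odot> R) \<and>
      pre_digraph.awalk (dual_graph C J) (L \<odot> (tgt p \<odot> R)) es v"
    by (auto simp: pre_digraph.awalk_def pre_digraph.cas.simps dual_graph_simps e)
  then show ?case by (simp add: Cons.IH e)
qed

lemma path_append: "path u (es @ es') w \<longleftrightarrow> (\<exists>v. path u es v \<and> path v es' w)"
  by (induction es arbitrary: u) (auto simp: path_seqs)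

lemma F_simps [simp]:
  "Obj F = seqs C"
  "(u, es, v) \<in> Arr F \<longleftrightarrow> path u es v"
  "Dom F (u, es, v) = u" "Cod F (u, es, v) = v" "Ident F u = (u, [], u)"
  "Comp F (v', es', w) (u, es, v) = (u, es @ es', w)"
  by (auto simp: free_dual_cat_def free_cat_def awalk_iff_path) (auto simp: dual_graph_simps)

definition whisk :: "'o list \<Rightarrow> 'o list \<Rightarrow> ('o, 'm) edge list \<Rightarrow> ('o, 'm) edge list" where
  "whisk T W = map (\<lambda>(L, p, R). (T \<odot> L, p, R \<odot> W))"

lemma whisk_simps [simp]:
  "whisk T W [] = []"
  "whisk T W ((L, p, R) # es) = (T \<odot> L, p, R \<odot> W) # whisk T W es"
  "whisk T W (es @ es') = whisk T W es @ whisk T W es'"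
  by (auto simp: whisk_def)

lemma path_whisk:
  "path u es v \<Longrightarrow> T \<in> seqs C \<Longrightarrow> W \<in> seqs C \<Longrightarrow>
    path (T \<odot> (u \<odot> W)) (whisk T W es) (T \<odot> (v \<odot> W))"
  by (induction u es v rule: path.induct) auto

lemma whisk_whisk:
  "path u es v \<Longrightarrow> T \<in> seqs C \<Longrightarrow> W \<in> seqs C \<Longrightarrow> T' \<in> seqs C \<Longrightarrow> W' \<in> seqs C \<Longrightarrow>
    whisk T' W' (whisk T W es) = whisk (T' \<odot> T) (W \<odot> W') es"
  by (induction u es v rule: path.induct) auto

lemma whisk_unit:
  "path u es v \<Longrightarrow> whisk [\<I>] [\<I>] es = es"
  by (induction u es v rule: path.induct) auto

lemma whisker_eq:
  assumes "path u es v" "T \<in> seqs C" "W \<in> seqs C"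
  shows "whisker C T (u, es, v) W = (T \<odot> (u \<odot> W), whisk T W es, T \<odot> (v \<odot> W))"
  using assms path_seqs[OF assms(1)]
  by (auto simp: whisker_def whisk_def whisker_edge_def split: prod.splits)

lemma edge_path_eq:
  "L \<in> seqs C \<Longrightarrow> p \<in> prims \<Longrightarrow> R \<in> seqs C \<Longrightarrow>
    edge_path (dual_graph C J) (L, p, R) = (L \<odot> (src p \<odot> R), [(L, p, R)], L \<odot> (tgt p \<odot> R))"
  by (simp add: edge_path_def dual_graph_simps)

lemma prim_path_eq:
  "p \<in> prims \<Longrightarrow> prim_path C J p = (src p, [([\<I>], p, [\<I>])], tgt p)"
  by (simp add: prim_path_def edge_path_eq seq_unit_def)

lemma whisker_prim_path:
  assumes "p \<in> prims" "T \<in> seqs C" "W \<in> seqs C"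
  shows "whisker C T (prim_path C J p) W = (T \<odot> (src p \<odot> W), [(T, p, W)], T \<odot> (tgt p \<odot> W))"
  using assms by (simp add: prim_path_eq whisker_eq)

section \<open>Running paths on chains, and soundness of the defining relations\<close>

definition run :: "('o, 'm) edge list \<Rightarrow> ('m \<times> 'o) list \<Rightarrow> ('m \<times> 'o) list" where
  "run = fold (\<lambda>(L, p, R). act L p R)"

lemma run_simps [simp]:
  "run [] cs = cs"
  "run ((L, p, R) # es) cs = run es (act L p R cs)"
  "run (es @ es') cs = run es' (run es cs)"
  by (auto simp: run_def)

lemma run_chain: "path u es v \<Longrightarrow> chain X u cs \<Longrightarrow> chain X v (run es cs)"
  by (induction u es v arbitrary: cs rule: path.induct) (auto simp: act_chain)

lemma run_chain_eq: "path u es v \<Longrightarrow> chain_eq X u cs cs' \<Longrightarrow> chain_eq X v (run es cs) (run es cs')"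
proof (induction u es v arbitrary: cs cs' rule: path.induct)
  case (2 u L p R es v)
  then show ?case by (auto intro: act_chain_eq)
qed auto

text \<open>Since \<open>T\<close> is nonempty, every edge whiskered by \<open>A # T\<close> acts
  beyond the first entry.\<close>

lemma run_whisk_Cons:
  "path u es v \<Longrightarrow> T \<in> seqs C \<Longrightarrow>
    run (whisk (A # T) W es) (c # cs) = c # run (whisk T W es) cs"
  by (induction u es v arbitrary: cs rule: path.induct)
     (auto simp: seq_tensor_Cons' act_Cons seqs_neq_Nil)

text \<open>All whiskerings are built in, so that closure under whiskering is immediate.\<close>

definition sound :: "('o, 'm) edge_seq \<Rightarrow> ('o, 'm) edge_seq \<Rightarrow> bool" where
  "sound l l' \<longleftrightarrow> (\<exists>u v es es'. l = (u, es, v) \<and> l' = (u, es', v) \<and> path u es v \<and> path u es' v \<and>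
    (\<forall>T W X cs. T \<in> seqs C \<longrightarrow> W \<in> seqs C \<longrightarrow> chain X (T \<odot> (u \<odot> W)) cs \<longrightarrow>
      chain_eq X (T \<odot> (v \<odot> W)) (run (whisk T W es) cs) (run (whisk T W es') cs)))"

text \<open>A longer prefix \<open>T\<close> only adds leading entries that are copied, so one-entry
  prefixes suffice. Exact equality is asked there; this fits the bar relations and the triangles,
  whereas interchange holds only up to sliding.\<close>

lemma sound_prefixI:
  assumes "path u es v" "path u es' v"
    and single: "\<And>A B R X cs. A \<in> Obj C \<Longrightarrow> B # R \<in> seqs C \<Longrightarrow> chain X ([A] \<odot> (u \<odot> (B # R))) cs \<Longrightarrow>
      run (whisk [A] (B # R) es) cs = run (whisk [A] (B # R) es') cs"
  shows "sound (u, es, v) (u, es', v)"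
proof -
  have "chain_eq X (T \<odot> (v \<odot> W)) (run (whisk T W es) cs) (run (whisk T W es') cs)"
    if "T \<in> seqs C" "W \<in> seqs C" "chain X (T \<odot> (u \<odot> W)) cs" for T W X cs
    using that
  proof (induction T arbitrary: X cs)
    case (Cons A T)
    show ?case
    proof (cases "T = []")
      case True
      obtain B R where W: "W = B # R" using Cons by (cases W) auto
      have "chain_eq X ([A] \<odot> (v \<odot> W)) (run (whisk [A] W es) cs) (run (whisk [A] W es) cs)"
        using Cons.prems True assms(1)
        by (intro chain_eq.refl run_chain[OF path_whisk]) auto
      then show ?thesis using single[of A B R X cs] True Cons.prems W by auto
    next
      case False
      then show ?thesis using Cons assms(1,2)
        by (auto simp: seq_tensor_Cons' Hom_iff run_whisk_Cons elim!: chain_ConsE intro!: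
            chain_eq.Cons)
    qed
  qed auto
  with assms show ?thesis by (auto simp: sound_def)
qed

lemma sound_whisker:
  assumes "sound l l'" "Y \<in> seqs C" "Z \<in> seqs C"
  shows "sound (whisker C Y l Z) (whisker C Y l' Z)"
proof -
  obtain u v es es' where l: "l = (u, es, v)" "l' = (u, es', v)" "path u es v" "path u es' v"
    and eq: "\<And>T W X cs. T \<in> seqs C \<Longrightarrow> W \<in> seqs C \<Longrightarrow> chain X (T \<odot> (u \<odot> W)) cs \<Longrightarrow>
      chain_eq X (T \<odot> (v \<odot> W)) (run (whisk T W es) cs) (run (whisk T W es') cs)"
    using assms(1) by (auto simp: sound_def)
  note [simp] = path_seqs[OF l(3)]
  have "chain_eq X (T \<odot> ((Y \<odot> (v \<odot> Z)) \<odot> W)) (run (whisk T W (whisk Y Z es)) cs)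
      (run (whisk T W (whisk Y Z es')) cs)"
    if "T \<in> seqs C" "W \<in> seqs C" "chain X (T \<odot> ((Y \<odot> (u \<odot> Z)) \<odot> W)) cs" for T W X cs
    using that assms(2,3) l(3,4) eq[of "T \<odot> Y" "Z \<odot> W" X cs] by (simp add: whisk_whisk[of u _ v])
  then show ?thesis using l assms(2,3) path_whisk[OF l(3)] path_whisk[OF l(4)]
    by (simp add: sound_def whisker_eq)
qed

text \<open>The bar relations reduce to the strict monoidal laws of \<open>C\<close>. In both
  triangles the unit inserts an identity entry, and the counit composes it with a neighbour.\<close>

lemma sound_dual_rel: "dual_rel C J l l' \<Longrightarrow> sound l l'"
proof (induction rule: dual_rel.induct)
  case (bar_whisker A B f)
  have "sound ([A \<otimes>\<^sub>o Dom C f \<otimes>\<^sub>o B], [([\<I>], Bar (Ident C A \<otimes> f \<otimes> Ident C B), [\<I>])], [A \<otimes>\<^sub>o Cod C f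
      \<otimes>\<^sub>o B])
    ([A \<otimes>\<^sub>o Dom C f \<otimes>\<^sub>o B], [([A], Bar f, [B])], [A \<otimes>\<^sub>o Cod C f \<otimes>\<^sub>o B])"
    using bar_whisker by (intro sound_prefixI) (auto elim!: chain_ConsE)
  moreover have "whisker C [A] (prim_path C J (Bar f)) [B] =
      ([A \<otimes>\<^sub>o Dom C f \<otimes>\<^sub>o B], [([A], Bar f, [B])], [A \<otimes>\<^sub>o Cod C f \<otimes>\<^sub>o B])"
    using bar_whisker by (simp add: whisker_prim_path)
  ultimately show ?case using bar_whisker by (simp add: prim_path_eq)
next
  case (bar_Ident A)
  have "sound ([A], [([\<I>], Bar (Ident C A), [\<I>])], [A]) ([A], [], [A])"
    using bar_Ident by (intro sound_prefixI) (auto elim!: chain_ConsE)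
  then show ?case using bar_Ident by (simp add: prim_path_eq)
next
  case (bar_Comp f A B g D)
  have "sound ([A], [([\<I>], Bar (g \<cdot> f), [\<I>])], [D])
      ([A], [([\<I>], Bar f, [\<I>]), ([\<I>], Bar g, [\<I>])], [D])"
    using bar_Comp by (intro sound_prefixI) (auto elim!: chain_ConsE simp: Hom_iff
        whisker_Comp_both)
  then show ?case using bar_Comp by (simp add: prim_path_eq Hom_iff)
next
  case (interchange a b U V W X)
  obtain L p M where a: "a = (L, p, M)" "L \<in> seqs C" "p \<in> prims" "M \<in> seqs C"
    using interchange(1) by (auto simp: dual_graph_simps)
  obtain M' q R where b: "b = (M', q, R)" "M' \<in> seqs C" "q \<in> prims" "R \<in> seqs C"
    using interchange(2) by (auto simp: dual_graph_simps)
  have ends: "U = L \<odot> (src p \<odot> M)" "V = L \<odot> (tgt p \<odot> M)"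
      "W = M' \<odot> (src q \<odot> R)" "X = M' \<odot> (tgt q \<odot> R)"
    using interchange(3-) a b by (auto simp: dual_graph_simps)
  have edges: "edge_path (dual_graph C J) a = (U, [a], V)"
      "edge_path (dual_graph C J) b = (W, [b], X)"
    "path U [a] V" "path W [b] X"
    using a b ends by (auto simp: edge_path_eq)
  \<comment> \<open>With \<open>a\<close> and \<open>b\<close> side by side, \<open>M\<close> and
    \<open>M'\<close> lie between the primitive edges and fuse to one middle sequence
    \<open>M \<odot> M'\<close>; the outer whiskers \<open>T\<close> and \<open>K\<close> are
    absorbed into \<open>L\<close> and \<open>R\<close>.\<close>
  have *: "chain_eq Z (T \<odot> (L \<odot> (tgt p \<odot> ((M \<odot> M') \<odot> (tgt q \<odot> (R \<odot> K))))))
      (act ((T \<odot> L) \<odot> (tgt p \<odot> (M \<odot> M'))) q (R \<odot> K)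
        (act (T \<odot> L) p ((M \<odot> M') \<odot> (src q \<odot> (R \<odot> K))) cs))
      (act (T \<odot> L) p ((M \<odot> M') \<odot> (tgt q \<odot> (R \<odot> K)))
        (act ((T \<odot> L) \<odot> (src p \<odot> (M \<odot> M'))) q (R \<odot> K) cs))"
    if "T \<in> seqs C" "K \<in> seqs C"
      "chain Z (T \<odot> (L \<odot> (src p \<odot> ((M \<odot> M') \<odot> (src q \<odot> (R \<odot> K)))))) cs" for T K Z cs
    using act_interchange[of Z "T \<odot> L" p "M \<odot> M'" q "R \<odot> K" cs] that a b by simp
  show ?case unfolding edges(1,2) using a b ends edges(3,4) *
    by (simp add: whisker_eq seq_unit_def sound_def)
next
  case triangle_obj
  have "sound ([J], [([J], Unit, [\<I>]), ([\<I>], Counit, [J])], [J]) ([J], [], [J])"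
    by (intro sound_prefixI) (auto elim!: chain_ConsE)
  then show ?case by (simp add: whisker_prim_path seq_unit_def)
next
  case triangle_dual
  have "sound ([\<I>, \<I>], [([\<I>], Unit, [\<I>, \<I>]), ([\<I>, \<I>], Counit, [\<I>])], [\<I>, \<I>]) ([\<I>, \<I>], [], [\<I>, \<I>])"
    by (intro sound_prefixI) (auto elim!: chain_ConsE)
  then show ?case by (simp add: whisker_prim_path seq_unit_def dual_obj_def)
next
  case (whiskered l l' Y Z)
  then show ?case by (intro sound_whisker)
qed

lemma soundE:
  assumes "sound l l'"
  obtains u v es es' where "l = (u, es, v)" "l' = (u, es', v)" "path u es v" "path u es' v"
    "\<And>T W X cs. T \<in> seqs C \<Longrightarrow> W \<in> seqs C \<Longrightarrow> chain X (T \<odot> (u \<odot> W)) cs \<Longrightarrow>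
      chain_eq X (T \<odot> (v \<odot> W)) (run (whisk T W es) cs) (run (whisk T W es') cs)"
  using assms by (auto simp: sound_def)

lemma sound_sym:
  assumes "sound l l'"
  shows "sound l' l"
  using assms by (rule soundE) (simp add: sound_def chain_eq.sym)

lemma sound_trans:
  assumes "sound l l'" "sound l' l''"
  shows "sound l l''"
proof -
  obtain u v es es' where l: "l = (u, es, v)" "l' = (u, es', v)" "path u es v" "path u es' v"
    and eq: "\<And>T W X cs. T \<in> seqs C \<Longrightarrow> W \<in> seqs C \<Longrightarrow> chain X (T \<odot> (u \<odot> W)) cs \<Longrightarrow>
      chain_eq X (T \<odot> (v \<odot> W)) (run (whisk T W es) cs) (run (whisk T W es') cs)"
    using assms(1) by (rule soundE) blast
  obtain es'' where l': "l'' = (u, es'', v)" "path u es'' v"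
    and eq': "\<And>T W X cs. T \<in> seqs C \<Longrightarrow> W \<in> seqs C \<Longrightarrow> chain X (T \<odot> (u \<odot> W)) cs \<Longrightarrow>
      chain_eq X (T \<odot> (v \<odot> W)) (run (whisk T W es') cs) (run (whisk T W es'') cs)"
    using assms(2) l by (auto elim!: soundE)
  have "chain_eq X (T \<odot> (v \<odot> W)) (run (whisk T W es) cs) (run (whisk T W es'') cs)"
    if "T \<in> seqs C" "W \<in> seqs C" "chain X (T \<odot> (u \<odot> W)) cs" for T W X cs
    using eq[OF that] eq'[OF that] by (rule chain_eq.trans)
  with l l' show ?thesis by (simp add: sound_def)
qed

lemma sound_congruence: "congruence_gen F (dual_rel C J) l l' \<Longrightarrow> sound l l'"
proof (induction rule: congruence_gen.induct)
  case (base f g)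
  then show ?case by (rule sound_dual_rel)
next
  case (refl f)
  obtain u es v where f: "f = (u, es, v)" by (cases f) auto
  with refl have "path u es v" by simp
  then show ?case by (auto simp: sound_def f intro!: chain_eq.refl run_chain[OF path_whisk])
next
  case (sym f g)
  from sym.IH show ?case by (rule sound_sym)
next
  case (trans f g h)
  from trans.IH show ?case by (rule sound_trans)
next
  case (comp f f' g g')
  obtain u v es es' where f: "f = (u, es, v)" "f' = (u, es', v)" "path u es v" "path u es' v"
    and feq: "\<And>T W X cs. T \<in> seqs C \<Longrightarrow> W \<in> seqs C \<Longrightarrow> chain X (T \<odot> (u \<odot> W)) cs \<Longrightarrow>
      chain_eq X (T \<odot> (v \<odot> W)) (run (whisk T W es) cs) (run (whisk T W es') cs)"
    using comp.IH(1) by (auto elim!: soundE)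
  obtain v' w fs fs' where g: "g = (v', fs, w)" "g' = (v', fs', w)" "path v' fs w" "path v' fs' w"
    and geq: "\<And>T W X cs. T \<in> seqs C \<Longrightarrow> W \<in> seqs C \<Longrightarrow> chain X (T \<odot> (v' \<odot> W)) cs \<Longrightarrow>
      chain_eq X (T \<odot> (w \<odot> W)) (run (whisk T W fs) cs) (run (whisk T W fs') cs)"
    using comp.IH(2) by (auto elim!: soundE)
  have [simp]: "v' = v" using comp.hyps(3) f g by simp
  have "chain_eq X (T \<odot> (w \<odot> W)) (run (whisk T W fs) (run (whisk T W es) cs))
      (run (whisk T W fs') (run (whisk T W es') cs))"
    if "T \<in> seqs C" "W \<in> seqs C" "chain X (T \<odot> (u \<odot> W)) cs" for T W X cs
  proof -
    note eq = feq[OF that]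
    have "chain X (T \<odot> (v \<odot> W)) (run (whisk T W es') cs)"
      using chain_eq_chain[OF eq] by simp
    from geq[OF that(1,2), simplified, OF this] run_chain_eq[OF path_whisk[OF g(3) that(1,2)],
        simplified, OF eq]
    show ?thesis by (blast intro: chain_eq.trans)
  qed
  with f g show ?case by (auto simp: sound_def path_append)
qed

text \<open>Common endpoints and typing are part of \<open>sound\<close>, so soundness also shows
  that congruent paths are parallel.\<close>

lemma congruence_paths:
  assumes "congruence_gen F (dual_rel C J) (u, es, v) l"
  obtains es' where "l = (u, es', v)" "path u es v" "path u es' v"
  using sound_congruence[OF assms] by (auto elim!: soundE)

section \<open>Calculus of congruent paths\<close>

lemma whisker_Comp_F:
  assumes "path u es v" "path v fs w" "T \<in> seqs C" "W \<in> seqs C"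
  shows "whisker C T (u, es @ fs, w) W =
    Comp F (whisker C T (v, fs, w) W) (whisker C T (u, es, v) W)"
proof -
  have "path u (es @ fs) w" using assms path_append by blast
  then show ?thesis using assms by (simp add: whisker_eq)
qed

text \<open>Whiskering respects composition of paths, and \<open>whiskered\<close> makes it send
  generating pairs to generating pairs.\<close>

lemma congruence_whisker:
  assumes "congruence_gen F (dual_rel C J) l l'" "T \<in> seqs C" "W \<in> seqs C"
  shows "congruence_gen F (dual_rel C J) (whisker C T l W) (whisker C T l' W)"
  using assms(1)
proof (induction rule: congruence_gen.induct)
  case (base f g)
  then show ?case using assms(2,3) by (intro congruence_gen.base dual_rel.whiskered)
next
  case (refl f)
  obtain u es v where f: "f = (u, es, v)" by (cases f) auto
  with refl show ?case using assms(2,3)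
    by (auto simp: whisker_eq intro!: congruence_gen.refl path_whisk)
next
  case (comp f f' g g')
  obtain u v es es' where f: "f = (u, es, v)" "f' = (u, es', v)" "path u es v" "path u es' v"
    using sound_congruence[OF comp.hyps(1)] by (auto elim!: soundE)
  obtain w fs fs' where g: "g = (v, fs, w)" "g' = (v, fs', w)" "path v fs w" "path v fs' w"
    using sound_congruence[OF comp.hyps(2)] comp.hyps(3) f by (auto elim!: soundE)
  have "congruence_gen F (dual_rel C J) (Comp F (whisker C T g W) (whisker C T f W))
      (Comp F (whisker C T g' W) (whisker C T f' W))"
    using comp.IH f g assms(2,3) by (intro congruence_gen.comp) (auto simp: whisker_eq)
  then show ?case using whisker_Comp_F[of u es v fs w T W] whisker_Comp_F[of u es' v fs' w T W]
    f g assms(2,3) by simp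
qed (blast intro: congruence_gen.sym congruence_gen.trans)+

definition path_eq :: "'o list \<Rightarrow> 'o list \<Rightarrow> ('o, 'm) edge list \<Rightarrow> ('o, 'm) edge list \<Rightarrow> bool" where
  "path_eq u v es es' \<longleftrightarrow> congruence_gen F (dual_rel C J) (u, es, v) (u, es', v)"

lemma path_eqD: "path_eq u v es es' \<Longrightarrow> path u es v" "path_eq u v es es' \<Longrightarrow> path u es' v"
  unfolding path_eq_def by (auto elim: congruence_paths)

lemma path_eq_refl: "path u es v \<Longrightarrow> path_eq u v es es"
  by (simp add: path_eq_def congruence_gen.refl)

lemma path_eq_sym: "path_eq u v es es' \<Longrightarrow> path_eq u v es' es"
  by (simp add: path_eq_def congruence_gen.sym)

lemma path_eq_trans [trans]: "path_eq u v es es' \<Longrightarrow> path_eq u v es' es'' \<Longrightarrow> path_eq u v es es''"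
  unfolding path_eq_def by (rule congruence_gen.trans)

lemma path_eq_append: "path_eq u v es es' \<Longrightarrow> path_eq v w fs fs' \<Longrightarrow> path_eq u w (es @ fs) (es' @ fs')"
  using congruence_gen.comp[of F "dual_rel C J" "(u, es, v)" "(u, es', v)" "(v, fs, w)"
      "(v, fs', w)"]
  by (simp add: path_eq_def)

lemma path_eq_context:
  "path_eq v w b b' \<Longrightarrow> path u a v \<Longrightarrow> path w c x \<Longrightarrow> path_eq u x (a @ b @ c) (a @ b' @ c)"
  by (intro path_eq_append path_eq_refl)

lemma path_eq_whisk:
  assumes "path_eq u v es es'" "T \<in> seqs C" "W \<in> seqs C"
  shows "path_eq (T \<odot> (u \<odot> W)) (T \<odot> (v \<odot> W)) (whisk T W es) (whisk T W es')"
  using congruence_whisker[of "(u, es, v)" "(u, es', v)" T W] path_eqD[OF assms(1)] assms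
  by (simp add: path_eq_def whisker_eq)

lemma path_eq_bar_whisker:
  assumes "A \<in> Obj C" "B \<in> Obj C" "f \<in> Arr C" "T \<in> seqs C" "W \<in> seqs C"
  shows "path_eq (T \<odot> ([A \<otimes>\<^sub>o Dom C f \<otimes>\<^sub>o B] \<odot> W)) (T \<odot> ([A \<otimes>\<^sub>o Cod C f \<otimes>\<^sub>o B] \<odot> W))
    [(T, Bar (Ident C A \<otimes> f \<otimes> Ident C B), W)] [(T \<odot> [A], Bar f, [B] \<odot> W)]"
proof -
  have 1: "whisker C [A] (prim_path C J (Bar f)) [B] =
      ([A \<otimes>\<^sub>o Dom C f \<otimes>\<^sub>o B], [([A], Bar f, [B])], [A \<otimes>\<^sub>o Cod C f \<otimes>\<^sub>o B])"
    using assms by (simp add: whisker_prim_path)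
  have "path_eq [A \<otimes>\<^sub>o Dom C f \<otimes>\<^sub>o B] [A \<otimes>\<^sub>o Cod C f \<otimes>\<^sub>o B]
      [([\<I>], Bar (Ident C A \<otimes> f \<otimes> Ident C B), [\<I>])] [([A], Bar f, [B])]"
    using dual_rel.bar_whisker[of A C B f J] assms
    unfolding path_eq_def 1 by (intro congruence_gen.base) (simp add: prim_path_eq)
  from path_eq_whisk[OF this assms(4,5)] show ?thesis using assms by simp
qed

lemma path_eq_bar_Ident:
  assumes "A \<in> Obj C" "T \<in> seqs C" "W \<in> seqs C"
  shows "path_eq (T \<odot> ([A] \<odot> W)) (T \<odot> ([A] \<odot> W)) [(T, Bar (Ident C A), W)] []"
proof -
  have "path_eq [A] [A] [([\<I>], Bar (Ident C A), [\<I>])] []"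
    using dual_rel.bar_Ident[of A C J] assms
    unfolding path_eq_def by (intro congruence_gen.base) (simp add: prim_path_eq)
  from path_eq_whisk[OF this assms(2,3)] show ?thesis using assms by simp
qed

lemma path_eq_bar_Comp:
  assumes "f \<in> Arr C" "g \<in> Arr C" "Dom C g = Cod C f" "T \<in> seqs C" "W \<in> seqs C"
  shows "path_eq (T \<odot> ([Dom C f] \<odot> W)) (T \<odot> ([Cod C g] \<odot> W))
    [(T, Bar (g \<cdot> f), W)] [(T, Bar f, W), (T, Bar g, W)]"
proof -
  have "path_eq [Dom C f] [Cod C g] [([\<I>], Bar (g \<cdot> f), [\<I>])] [([\<I>], Bar f, [\<I>]), ([\<I>], Bar g,
      [\<I>])]"
    using dual_rel.bar_Comp[of f C "Dom C f" "Cod C f" g "Cod C g" J] assms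
    unfolding path_eq_def by (intro congruence_gen.base) (simp add: prim_path_eq Hom_iff)
  from path_eq_whisk[OF this assms(4,5)] show ?thesis using assms by simp
qed

lemma path_eq_triangle_obj:
  assumes "T \<in> seqs C" "W \<in> seqs C"
  shows "path_eq (T \<odot> ([J] \<odot> W)) (T \<odot> ([J] \<odot> W)) [(T \<odot> [J], Unit, W), (T, Counit, [J] \<odot> W)] []"
proof -
  have "path_eq [J] [J] [([J], Unit, [\<I>]), ([\<I>], Counit, [J])] []"
    using dual_rel.triangle_obj[of C J]
    unfolding path_eq_def by (intro congruence_gen.base) (simp add: whisker_prim_path seq_unit_def)
  from path_eq_whisk[OF this assms] show ?thesis using assms by simp
qed

lemma path_eq_interchange:
  assumes "L \<in> seqs C" "p \<in> prims" "M \<in> seqs C" "q \<in> prims" "R \<in> seqs C"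
  shows "path_eq (L \<odot> (src p \<odot> (M \<odot> (src q \<odot> R)))) (L \<odot> (tgt p \<odot> (M \<odot> (tgt q \<odot> R))))
    [(L, p, M \<odot> (src q \<odot> R)), (L \<odot> (tgt p \<odot> M), q, R)]
    [(L \<odot> (src p \<odot> M), q, R), (L, p, M \<odot> (tgt q \<odot> R))]"
proof -
  \<comment> \<open>The whole gap \<open>M\<close> is put into the right whisker of the first edge,
    so the second one starts with the trivial whisker \<open>[\<I>]\<close>.\<close>
  let ?a = "(L, p, M)" and ?b = "([\<I>], q, R)"
  have "?a \<in> arcs (dual_graph C J)" "?b \<in> arcs (dual_graph C J)"
    using assms by (auto simp: dual_graph_simps)
  from dual_rel.interchange[OF this HOL.refl HOL.refl HOL.refl HOL.refl]
  show ?thesis unfolding path_eq_def using assms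
    by (intro congruence_gen.base) (simp add: edge_path_eq whisker_eq dual_graph_simps seq_unit_def)
qed

text \<open>Interchange repeated along \<open>es\<close>. It carries an edge acting at an early
  entry past everything built to its right, to the end of the path.\<close>

lemma path_eq_move:
  assumes "path U es V" "L \<in> seqs C" "p \<in> prims" "M \<in> seqs C"
  shows "path_eq (L \<odot> (src p \<odot> (M \<odot> U))) (L \<odot> (tgt p \<odot> (M \<odot> V)))
    ((L, p, M \<odot> U) # whisk (L \<odot> (tgt p \<odot> M)) [\<I>] es) (whisk (L \<odot> (src p \<odot> M)) [\<I>] es @ [(L, p, M \<odot>
        V)])"
  using assms(1)
proof (induction U es V rule: path.induct)
  case (1 u v)
  then show ?case using assms by (auto intro!: path_eq_refl)
next
  case (2 u K q R es v)
  have q: "K \<in> seqs C" "q \<in> prims" "R \<in> seqs C" "u = K \<odot> (src q \<odot> R)" "path (K \<odot> (tgt q \<odot> R)) es v"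
    using 2 by auto
  have "path (L \<odot> (tgt p \<odot> (M \<odot> (K \<odot> (tgt q \<odot> R))))) (whisk (L \<odot> (tgt p \<odot> M)) [\<I>] es)
      (L \<odot> (tgt p \<odot> (M \<odot> v)))"
    using path_whisk[OF q(5), of "L \<odot> (tgt p \<odot> M)" "[\<I>]"] q assms path_seqs[OF q(5)] by simp
  then have "path_eq (L \<odot> (src p \<odot> (M \<odot> u))) (L \<odot> (tgt p \<odot> (M \<odot> v)))
      ((L, p, M \<odot> u) # whisk (L \<odot> (tgt p \<odot> M)) [\<I>] ((K, q, R) # es))
      ((L \<odot> (src p \<odot> (M \<odot> K)), q, R) # (L, p, M \<odot> (K \<odot> (tgt q \<odot> R))) # whisk (L \<odot> (tgt p \<odot> M)) [\<I>]
          es)"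
    using path_eq_append[OF path_eq_interchange[of L p "M \<odot> K" q R] path_eq_refl] q assms by simp
  also have "path_eq (L \<odot> (src p \<odot> (M \<odot> u))) (L \<odot> (tgt p \<odot> (M \<odot> v))) \<dots>
      (whisk (L \<odot> (src p \<odot> M)) [\<I>] ((K, q, R) # es) @ [(L, p, M \<odot> v)])"
    using path_eq_append[OF path_eq_refl, of "L \<odot> (src p \<odot> (M \<odot> u))"
        "[(L \<odot> (src p \<odot> (M \<odot> K)), q, R)]", OF _ 2(1)] q assms
    by simp
  finally show ?case .
qed

section \<open>The path of a chain\<close>

text \<open>\<open>[\<I>, \<I>]\<close> is \<open>J\<^sup>\<or>\<close>: after \<open>g\<close>, the
  unit turns \<open>[Y]\<close> into \<open>[\<I>, J \<otimes> Y]\<close>, where the path of the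
  remaining chain, starting at \<open>[J \<otimes> Y]\<close>, is whiskered by
  \<open>J\<^sup>\<or>\<close>. This is the composite defining \<open>\<zeta>\<close>,
  iterated.\<close>

fun walk_of :: "'o list \<Rightarrow> ('m \<times> 'o) list \<Rightarrow> ('o, 'm) edge list" where
  "walk_of (A # V) ((g, Y) # cs) = ([\<I>], Bar g, [\<I>]) # whisk [A] [\<I>]
     (if V = [] then [] else ([\<I>], Unit, [Y]) # whisk [\<I>, \<I>] [\<I>] (walk_of V cs))"
| "walk_of _ _ = []"

text \<open>\<open>[Y] \<rightarrow> \<I> # V\<close>: the part of the path that an edge acting on the first entry has to be moved past.\<close>

definition rest :: "'o list \<Rightarrow> 'o \<Rightarrow> ('m \<times> 'o) list \<Rightarrow> ('o, 'm) edge list" where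
  "rest V Y cs = (if V = [] then [] else ([\<I>], Unit, [Y]) # whisk [\<I>, \<I>] [\<I>] (walk_of V cs))"

lemma walk_of_rest: "walk_of (A # V) ((g, Y) # cs) = ([\<I>], Bar g, [\<I>]) # whisk [A] [\<I>] (rest V Y
    cs)"
  by (simp add: rest_def)

lemma path_walk_of: "chain X V cs \<Longrightarrow> path [X] (walk_of V cs) V"
proof (induction X V cs rule: chain.induct)
  case (1 X A V g Y cs)
  show ?case
  proof (cases "V = []")
    case False
    then have IH: "path [J \<otimes>\<^sub>o Y] (walk_of V cs) V" "V \<in> seqs C" using 1 by (auto intro: path_seqs)
    from path_whisk[OF path_whisk[OF IH(1), of "[\<I>, \<I>]" "[\<I>]"], of "[A]" "[\<I>]"]
    show ?thesis using 1(2) False IH chain_Obj[OF 1(2)] by (simp add: seq_tensor_Cons')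
  qed (use 1 in auto)
qed auto

lemma path_rest:
  assumes "if V = [] then Y = \<I> \<and> cs = [] else chain (J \<otimes>\<^sub>o Y) V cs" "Y \<in> Obj C"
  shows "path [Y] (rest V Y cs) (\<I> # V)"
proof (cases "V = []")
  case False
  then have "path [J \<otimes>\<^sub>o Y] (walk_of V cs) V" using assms path_walk_of by simp
  from path_whisk[OF this, of "[\<I>, \<I>]" "[\<I>]"] path_seqs(2)[OF this]
  show ?thesis using False assms by (simp add: rest_def seq_tensor_Cons')
qed (use assms in \<open>auto simp: rest_def\<close>)

lemma walk_of_Cons:
  assumes "chain (J \<otimes>\<^sub>o Y) V cs" "A \<in> Obj C" "Y \<in> Obj C"
  shows "walk_of (A # V) ((g, Y) # cs) =
    ([\<I>], Bar g, [\<I>]) # ([A], Unit, [Y]) # whisk [A, \<I>] [\<I>] (walk_of V cs)"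
proof -
  have "V \<noteq> []" using assms by auto
  then show ?thesis using assms path_walk_of[OF assms(1)]
    by (simp add: whisk_whisk[of _ _ V])
qed

lemma path_eq_Cons: "path_eq v w es es' \<Longrightarrow> path u [e] v \<Longrightarrow> path_eq u w (e # es) (e # es')"
  using path_eq_append[OF path_eq_refl, of u "[e]" v w es es'] by simp

text \<open>Only the first edge sees \<open>k\<close>, and \<open>bar_Comp\<close> splits it in
  two.\<close>

lemma walk_of_precomp:
  assumes "chain X V cs" "k \<in> Hom C X' X"
  shows "path_eq [X'] V (walk_of V (precomp k cs)) (([\<I>], Bar k, [\<I>]) # walk_of V cs)"
proof -
  obtain A V' where V: "V = A # V'" using assms by (cases V) auto
  obtain g Y cs' where cs: "cs = (g, Y) # cs'" "g \<in> Arr C" "Dom C g = X" "Cod C g = A \<otimes>\<^sub>o Y"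
    "A \<in> Obj C" "Y \<in> Obj C" and rest: "if V' = [] then Y = \<I> \<and> cs' = [] else chain (J \<otimes>\<^sub>o Y) V' cs'"
    using assms unfolding V by (auto elim!: chain_ConsE)
  have V': "V' = [] \<or> V' \<in> seqs C" using rest by (auto split: if_splits dest: chain_seqs)
  have p: "path [A \<otimes>\<^sub>o Y] (whisk [A] [\<I>] (rest V' Y cs')) V"
    using path_whisk[OF path_rest[OF rest cs(6)], of "[A]" "[\<I>]"] cs V V' by auto
  show ?thesis
    using path_eq_append[OF path_eq_bar_Comp[of k g "[\<I>]" "[\<I>]"] path_eq_refl, of _ V] p assms cs V
    by (auto simp: walk_of_rest Hom_iff simp del: walk_of.simps)
qed

text \<open>A slide in terms of paths: strip \<open>A\<close> off the bar, interchange with the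
  unit, and absorb the \<open>J\<close> produced by the unit into the bar.\<close>

lemma path_eq_slide_Unit:
  assumes "A \<in> Obj C" "k \<in> Hom C Y Y'"
  shows "path_eq [A \<otimes>\<^sub>o Y] [A, J \<otimes>\<^sub>o Y']
    [([\<I>], Bar (Ident C A \<otimes> k), [\<I>]), ([A], Unit, [Y'])]
    [([A], Unit, [Y]), ([A, \<I>], Bar (Ident C J \<otimes> k), [\<I>])]"
proof -
  have k: "k \<in> Arr C" "Dom C k = Y" "Cod C k = Y'" "Y \<in> Obj C" "Y' \<in> Obj C" using assms by (auto
      simp: Hom_iff)
  have "path_eq [A \<otimes>\<^sub>o Y] [A, J \<otimes>\<^sub>o Y'] [([\<I>], Bar (Ident C A \<otimes> k), [\<I>]), ([A], Unit, [Y'])]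
      [([A], Bar k, [\<I>]), ([A], Unit, [Y'])]"
    using path_eq_append[OF path_eq_bar_whisker[of A \<I> k "[\<I>]" "[\<I>]"] path_eq_refl] assms k by simp
  also have "path_eq [A \<otimes>\<^sub>o Y] [A, J \<otimes>\<^sub>o Y'] \<dots> [([A], Unit, [Y]), ([A, J], Bar k, [\<I>])]"
    using path_eq_interchange[of "[A]" Unit "[\<I>]" "Bar k" "[\<I>]"] assms k by (simp add: path_eq_sym)
  also have "path_eq [A \<otimes>\<^sub>o Y] [A, J \<otimes>\<^sub>o Y'] \<dots> [([A], Unit, [Y]), ([A, \<I>], Bar (Ident C J \<otimes> k),
      [\<I>])]"
    using path_eq_Cons[OF path_eq_sym[OF path_eq_bar_whisker[of J \<I> k "[A, \<I>]" "[\<I>]"]], of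
        "[A \<otimes>\<^sub>o Y]" "([A], Unit, [Y])"]
      assms k by simp
  finally show ?thesis .
qed

text \<open>In the case \<open>slide\<close>, \<open>k\<close> is split off the first bar, passes
  the unit and is absorbed by the first bar of the remaining walk.\<close>

lemma walk_of_chain_eq: "chain_eq X V cs cs' \<Longrightarrow> path_eq [X] V (walk_of V cs) (walk_of V cs')"
proof (induction rule: chain_eq.induct)
  case (slide g X A Y k Y' V cs)
  have k: "k \<in> Arr C" "Dom C k = Y" "Cod C k = Y'" "Y \<in> Obj C" "Y' \<in> Obj C" using slide by (auto
      simp: Hom_iff)
  have g: "g \<in> Arr C" "Dom C g = X" "Cod C g = A \<otimes>\<^sub>o Y" "X \<in> Obj C" using slide by (auto simp:
      Hom_iff)
  have V: "V \<in> seqs C" using slide chain_seqs by blast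
  let ?W = "whisk [A, \<I>] [\<I>] (walk_of V cs)"
  have W: "path [A, J \<otimes>\<^sub>o Y'] ?W (A # V)"
    using path_whisk[OF path_walk_of[OF slide(4)], of "[A, \<I>]" "[\<I>]"] slide k V by (simp add:
        seq_tensor_Cons')
  have pre: "chain (J \<otimes>\<^sub>o Y) V (precomp (Ident C J \<otimes> k) cs)"
    using slide k by (intro chain_precomp[OF slide(4)]) (auto simp: Hom_iff)
  have "path_eq [X] (A # V) (walk_of (A # V) (((Ident C A \<otimes> k) \<cdot> g, Y') # cs))
      ([([\<I>], Bar g, [\<I>]), ([\<I>], Bar (Ident C A \<otimes> k), [\<I>])] @ ([A], Unit, [Y']) # ?W)"
    using path_eq_append[OF path_eq_bar_Comp[of g "Ident C A \<otimes> k" "[\<I>]" "[\<I>]"] path_eq_refl] slide g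
        k W V
    by (simp add: walk_of_Cons del: walk_of.simps)
  also have "path_eq [X] (A # V) \<dots>
      ([([\<I>], Bar g, [\<I>])] @ [([A], Unit, [Y]), ([A, \<I>], Bar (Ident C J \<otimes> k), [\<I>])] @ ?W)"
    using path_eq_context[OF path_eq_slide_Unit[OF slide(2,3)], of "[X]" "[([\<I>], Bar g, [\<I>])]" ?W
        "A # V"] g k W slide
    by simp
  also have "\<dots> = ([([\<I>], Bar g, [\<I>]), ([A], Unit, [Y])] @ whisk [A, \<I>] [\<I>] (([\<I>], Bar (Ident C J \<otimes>
      k), [\<I>]) # walk_of V cs))"
    by simp
  also have "path_eq [X] (A # V) \<dots>
     ([([\<I>], Bar g, [\<I>]), ([A], Unit, [Y])] @ whisk [A, \<I>] [\<I>] (walk_of V (precomp (Ident C J \<otimes> k)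
         cs)))"
  proof -
    have "path_eq [A, J \<otimes>\<^sub>o Y] (A # V) (whisk [A, \<I>] [\<I>] (([\<I>], Bar (Ident C J \<otimes> k), [\<I>]) # walk_of
        V cs))
      (whisk [A, \<I>] [\<I>] (walk_of V (precomp (Ident C J \<otimes> k) cs)))"
      using path_eq_whisk[OF path_eq_sym[OF walk_of_precomp[OF slide(4), of "Ident C J \<otimes> k"
          "J \<otimes>\<^sub>o Y"]], of "[A, \<I>]" "[\<I>]"] k slide V
      by (simp add: Hom_iff seq_tensor_Cons')
    then show ?thesis using g k slide by (intro path_eq_append path_eq_refl) auto
  qed
  also have "\<dots> = walk_of (A # V) ((g, Y) # precomp (Ident C J \<otimes> k) cs)"
    using slide k pre by (simp add: walk_of_Cons del: walk_of.simps)
  finally show ?case .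
next
  case (Cons g X A Y V cs cs')
  have c: "chain (J \<otimes>\<^sub>o Y) V cs" "chain (J \<otimes>\<^sub>o Y) V cs'" using chain_eq_chain[OF Cons(4)] by auto
  then have V: "V \<in> seqs C" using chain_seqs by blast
  have "path_eq [A, J \<otimes>\<^sub>o Y] (A # V) (whisk [A, \<I>] [\<I>] (walk_of V cs)) (whisk [A, \<I>] [\<I>] (walk_of V
      cs'))"
    using path_eq_whisk[OF Cons.IH, of "[A, \<I>]" "[\<I>]"] Cons V by (simp add: seq_tensor_Cons')
  then show ?case using Cons V c
    by (auto simp: walk_of_Cons Hom_iff simp del: walk_of.simps intro!: path_eq_Cons)
next
  case (refl X V cs)
  then show ?case by (intro path_eq_refl path_walk_of)
qed (blast intro: path_eq_sym path_eq_trans)+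

text \<open>Acting by an edge amounts to appending it. The walk of the new chain is rewritten at its
  beginning until \<open>p\<close> appears as an edge of its own, and \<open>path_eq_move\<close>
  then takes that edge past the rest to the end.\<close>

lemma walk_of_prim_act:
  assumes "chain X ([A] \<odot> (src p \<odot> (B # R))) cs" "A \<in> Obj C" "B # R \<in> seqs C" "p \<in> prims"
  shows "path_eq [X] ([A] \<odot> (tgt p \<odot> (B # R))) (walk_of ([A] \<odot> (tgt p \<odot> (B # R))) (prim_act A p B
      cs))
    (walk_of ([A] \<odot> (src p \<odot> (B # R))) cs @ [([A], p, B # R)])"
proof (cases p)
  case (Bar f)
  from assms Bar obtain g Y cs' where cs: "cs = (g, Y) # cs'" "g \<in> Arr C" "Dom C g = X"
    "Cod C g = A \<otimes>\<^sub>o Dom C f \<otimes>\<^sub>o B \<otimes>\<^sub>o Y" "Y \<in> Obj C"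
        "if R = [] then Y = \<I> \<and> cs' = [] else chain (J \<otimes>\<^sub>o Y) R cs'"
    by (auto elim!: chain_ConsE split del: if_split)
  have f: "f \<in> Arr C" "B \<in> Obj C" "R = [] \<or> R \<in> seqs C" "X \<in> Obj C"
    using assms Bar chain_Obj by auto
  let ?\<rho> = "rest R Y cs'" and ?k = "Ident C A \<otimes> f \<otimes> Ident C (B \<otimes>\<^sub>o Y)"
  let ?V = "(A \<otimes>\<^sub>o Cod C f \<otimes>\<^sub>o B) # R"
  have \<rho>: "path [Y] ?\<rho> (\<I> # R)" using cs by (intro path_rest) auto
  have \<rho>': "path [A \<otimes>\<^sub>o Cod C f \<otimes>\<^sub>o B \<otimes>\<^sub>o Y] (whisk [A \<otimes>\<^sub>o Cod C f \<otimes>\<^sub>o B] [\<I>] ?\<rho>) ?V"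
    using path_whisk[OF \<rho>, of "[A \<otimes>\<^sub>o Cod C f \<otimes>\<^sub>o B]" "[\<I>]"] assms f cs by auto
  have "path_eq [X] ?V (([\<I>], Bar (?k \<cdot> g), [\<I>]) # whisk [A \<otimes>\<^sub>o Cod C f \<otimes>\<^sub>o B] [\<I>] ?\<rho>)
      (([\<I>], Bar g, [\<I>]) # ([\<I>], Bar ?k, [\<I>]) # whisk [A \<otimes>\<^sub>o Cod C f \<otimes>\<^sub>o B] [\<I>] ?\<rho>)"
    using path_eq_append[OF path_eq_bar_Comp[of g ?k "[\<I>]" "[\<I>]"] path_eq_refl, of _ ?V] \<rho>' f cs
        assms by simp
  also have "path_eq [X] ?V \<dots> (([\<I>], Bar g, [\<I>]) # ([A], Bar f, [B \<otimes>\<^sub>o Y]) # whisk [A \<otimes>\<^sub>o Cod C f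
      \<otimes>\<^sub>o B] [\<I>] ?\<rho>)"
    using path_eq_context[OF path_eq_bar_whisker[of A "B \<otimes>\<^sub>o Y" f "[\<I>]" "[\<I>]"], of "[X]"
        "[([\<I>], Bar g, [\<I>])]" _ ?V] \<rho>' f cs assms
    by simp
  also have "path_eq [X] ?V \<dots> (([\<I>], Bar g, [\<I>]) # whisk [A \<otimes>\<^sub>o Dom C f \<otimes>\<^sub>o B] [\<I>] ?\<rho> @ [([A], Bar
      f, B # R)])"
    using path_eq_Cons[OF path_eq_move[OF \<rho>, of "[A]" "Bar f" "[B]"], of "[X]" "([\<I>], Bar g, [\<I>])"]
        f cs assms by auto
  finally show ?thesis using Bar cs assms f by (simp add: walk_of_rest del: walk_of.simps)
next
  case Counit
  from assms Counit obtain g Y h Y' cs' where cs: "cs = (g, Y) # (h, Y') # cs'" "g \<in> Arr C"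
      "Dom C g = X"
    "Cod C g = A \<otimes>\<^sub>o J \<otimes>\<^sub>o Y" "Y \<in> Obj C" "h \<in> Arr C" "Dom C h = J \<otimes>\<^sub>o Y" "Cod C h = B \<otimes>\<^sub>o Y'"
        "Y' \<in> Obj C"
    "if R = [] then Y' = \<I> \<and> cs' = [] else chain (J \<otimes>\<^sub>o Y') R cs'"
    by (auto elim!: chain_ConsE split del: if_split)
  have B: "B \<in> Obj C" "R = [] \<or> R \<in> seqs C" "X \<in> Obj C"
    using assms chain_Obj by auto
  let ?V = "(A \<otimes>\<^sub>o B) # R" and ?\<rho> = "rest R Y' cs'"
  let ?r = "([\<I>], Bar h, [\<I>]) # whisk [B] [\<I>] ?\<rho>"
  have r: "?r = walk_of (B # R) ((h, Y') # cs')" "path [J \<otimes>\<^sub>o Y] ?r (B # R)"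
    using path_walk_of[of "J \<otimes>\<^sub>o Y" "B # R" "(h, Y') # cs'"] cs B by (auto simp: walk_of_rest simp
        del: walk_of.simps)
  have \<rho>: "path [Y'] ?\<rho> (\<I> # R)" using cs by (intro path_rest) auto
  have \<rho>': "path [A \<otimes>\<^sub>o B \<otimes>\<^sub>o Y'] (whisk [A \<otimes>\<^sub>o B] [\<I>] ?\<rho>) ?V"
    using path_whisk[OF \<rho>, of "[A \<otimes>\<^sub>o B]" "[\<I>]"] assms B cs by auto
  have w: "whisk [A] [\<I>] (whisk [B] [\<I>] ?\<rho>) = whisk [A \<otimes>\<^sub>o B] [\<I>] ?\<rho>"
    using whisk_whisk[OF \<rho>, of "[B]" "[\<I>]" "[A]" "[\<I>]"] B assms by simp
  have "path_eq [X] ?V (([\<I>], Bar ((Ident C A \<otimes> h) \<cdot> g), [\<I>]) # whisk [A \<otimes>\<^sub>o B] [\<I>] ?\<rho>)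
     (([\<I>], Bar g, [\<I>]) # ([\<I>], Bar (Ident C A \<otimes> h), [\<I>]) # whisk [A \<otimes>\<^sub>o B] [\<I>] ?\<rho>)"
    using path_eq_append[OF path_eq_bar_Comp[of g "Ident C A \<otimes> h" "[\<I>]" "[\<I>]"] path_eq_refl, of _
        ?V] \<rho>' B cs assms by simp
  also have "path_eq [X] ?V \<dots> (([\<I>], Bar g, [\<I>]) # ([A], Bar h, [\<I>]) # whisk [A \<otimes>\<^sub>o B] [\<I>] ?\<rho>)"
    using path_eq_context[OF path_eq_bar_whisker[of A \<I> h "[\<I>]" "[\<I>]"], of "[X]"
        "[([\<I>], Bar g, [\<I>])]" _ ?V] \<rho>' B cs assms
    by simp
  also have "\<dots> = [([\<I>], Bar g, [\<I>])] @ [] @ whisk [A] [\<I>] ?r" using w assms by simp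
  \<comment> \<open>The counit has merged \<open>g\<close> and \<open>h\<close>, so the walk has no
    unit between them. The triangle identity read backwards inserts one, together with the counit
    edge that is then moved to the end.\<close>
  also have "path_eq [X] ?V \<dots> ([([\<I>], Bar g, [\<I>])] @ [([A \<otimes>\<^sub>o J], Unit, [Y]), ([A], Counit, [J \<otimes>\<^sub>o
      Y])] @ whisk [A] [\<I>] ?r)"
  proof -
    have "path [A \<otimes>\<^sub>o J \<otimes>\<^sub>o Y] (whisk [A] [\<I>] ?r) ?V"
      using path_whisk[OF r(2), of "[A]" "[\<I>]"] assms B cs by (auto simp del: whisk_simps)
    then show ?thesis
    using path_eq_context[OF path_eq_sym[OF path_eq_triangle_obj[of "[A]" "[Y]"]], of "[X]"
        "[([\<I>], Bar g, [\<I>])]" "whisk [A] [\<I>] ?r" ?V] B cs assms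
    by (simp del: whisk_simps)
  qed
  also have "\<dots> = ([([\<I>], Bar g, [\<I>]), ([A \<otimes>\<^sub>o J], Unit, [Y])] @ ([A], Counit, [J \<otimes>\<^sub>o Y]) # whisk [A]
      [\<I>] ?r)"
    by simp
  also have "path_eq [X] ?V \<dots> ([([\<I>], Bar g, [\<I>]), ([A \<otimes>\<^sub>o J], Unit, [Y])] @ whisk [A \<otimes>\<^sub>o J, \<I>] [\<I>]
      ?r @ [([A], Counit, B # R)])"
    using path_eq_append[OF path_eq_refl path_eq_move[OF r(2), of "[A]" Counit "[\<I>]"], of "[X]"
        "[([\<I>], Bar g, [\<I>]), ([A \<otimes>\<^sub>o J], Unit, [Y])]"]
      B cs assms by (auto simp del: whisk_simps)
  also have "\<dots> = walk_of ([A] \<odot> (src p \<odot> (B # R))) cs @ [([A], p, B # R)]"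
    using cs Counit assms B unfolding r(1) by (simp add: walk_of_Cons del: walk_of.simps
        whisk_simps)
  finally show ?thesis using Counit cs assms B by (simp add: walk_of_rest del: walk_of.simps)
next
  case Unit
  from assms Unit obtain g Y cs' where cs: "cs = (g, Y) # cs'" "g \<in> Arr C" "Dom C g = X"
    "Cod C g = A \<otimes>\<^sub>o B \<otimes>\<^sub>o Y" "Y \<in> Obj C"
        "if R = [] then Y = \<I> \<and> cs' = [] else chain (J \<otimes>\<^sub>o Y) R cs'"
    by (auto elim!: chain_ConsE split del: if_split)
  have B: "B \<in> Obj C" "R = [] \<or> R \<in> seqs C" "X \<in> Obj C"
    using assms chain_Obj by auto
  let ?V = "A # (J \<otimes>\<^sub>o B) # R" and ?\<rho> = "rest R Y cs'"
  let ?i = "Ident C (J \<otimes>\<^sub>o B \<otimes>\<^sub>o Y)"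
  have \<rho>: "path [Y] ?\<rho> (\<I> # R)" using cs by (intro path_rest) auto
  have \<rho>': "path [A, J \<otimes>\<^sub>o B \<otimes>\<^sub>o Y] (whisk [A, J \<otimes>\<^sub>o B] [\<I>] ?\<rho>) ?V"
    using path_whisk[OF \<rho>, of "[A, J \<otimes>\<^sub>o B]" "[\<I>]"] assms B cs by auto
  have c: "chain (J \<otimes>\<^sub>o (B \<otimes>\<^sub>o Y)) ((J \<otimes>\<^sub>o B) # R) ((?i, Y) # cs')" using B cs by auto
  have w: "whisk [A, \<I>] [\<I>] (whisk [J \<otimes>\<^sub>o B] [\<I>] ?\<rho>) = whisk [A, J \<otimes>\<^sub>o B] [\<I>] ?\<rho>"
    using whisk_whisk[OF \<rho>, of "[J \<otimes>\<^sub>o B]" "[\<I>]" "[A, \<I>]" "[\<I>]"] B assms by simp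
  have "walk_of ?V ((g, B \<otimes>\<^sub>o Y) # (?i, Y) # cs') =
      ([\<I>], Bar g, [\<I>]) # ([A], Unit, [B \<otimes>\<^sub>o Y]) # ([A, \<I>], Bar ?i, [\<I>]) # whisk [A, J \<otimes>\<^sub>o B] [\<I>]
          ?\<rho>"
    using c assms B cs w by (subst walk_of_Cons) (auto simp: walk_of_rest simp del: walk_of.simps)
  \<comment> \<open>The entry inserted by the unit is an identity, whose bar is congruent to the
    empty path.\<close>
  also have "path_eq [X] ?V \<dots> (([\<I>], Bar g, [\<I>]) # ([A], Unit, [B \<otimes>\<^sub>o Y]) # whisk [A, J \<otimes>\<^sub>o B] [\<I>]
      ?\<rho>)"
    using path_eq_context[OF path_eq_bar_Ident[of "J \<otimes>\<^sub>o B \<otimes>\<^sub>o Y" "[A, \<I>]" "[\<I>]"], of "[X]"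
        "[([\<I>], Bar g, [\<I>]), ([A], Unit, [B \<otimes>\<^sub>o Y])]" _ ?V]
      \<rho>' B cs assms by simp
  also have "path_eq [X] ?V \<dots> (([\<I>], Bar g, [\<I>]) # whisk [A \<otimes>\<^sub>o B] [\<I>] ?\<rho> @ [([A], Unit, B # R)])"
    using path_eq_Cons[OF path_eq_move[OF \<rho>, of "[A]" Unit "[B]"], of "[X]" "([\<I>], Bar g, [\<I>])"] B
        cs assms by auto
  finally show ?thesis using Unit cs assms B by (simp add: walk_of_rest del: walk_of.simps)
qed

lemma walk_of_act:
  assumes "chain X (L \<odot> (src p \<odot> R)) cs" "L \<in> seqs C" "R \<in> seqs C" "p \<in> prims"
  shows "path_eq [X] (L \<odot> (tgt p \<odot> R)) (walk_of (L \<odot> (tgt p \<odot> R)) (act L p R cs))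
    (walk_of (L \<odot> (src p \<odot> R)) cs @ [(L, p, R)])"
  using assms
proof (induction L arbitrary: X cs)
  case (Cons A L)
  show ?case
  proof (cases "L = []")
    case True
    obtain B R' where "R = B # R'" using Cons.prems by (cases R) auto
    then show ?thesis using walk_of_prim_act[of X A p B R' cs] True Cons.prems by simp
  next
    case False
    then obtain g Y cs' where cs: "cs = (g, Y) # cs'" "g \<in> Arr C" "Dom C g = X"
      "Cod C g = A \<otimes>\<^sub>o Y" "Y \<in> Obj C" "chain (J \<otimes>\<^sub>o Y) (L \<odot> (src p \<odot> R)) cs'"
      using Cons.prems by (auto simp: seq_tensor_Cons' elim!: chain_ConsE)
    have L: "A \<in> Obj C" "L \<in> seqs C" using False Cons.prems by auto
    have "chain (J \<otimes>\<^sub>o Y) (L \<odot> (tgt p \<odot> R)) (act L p R cs')"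
      using cs L Cons.prems by (intro act_chain) auto
    moreover have "path_eq [A, J \<otimes>\<^sub>o Y] (A # (L \<odot> (tgt p \<odot> R)))
       (whisk [A, \<I>] [\<I>] (walk_of (L \<odot> (tgt p \<odot> R)) (act L p R cs')))
       (whisk [A, \<I>] [\<I>] (walk_of (L \<odot> (src p \<odot> R)) cs') @ [(A # L, p, R)])"
      using path_eq_whisk[OF Cons.IH[OF cs(6)], of "[A, \<I>]" "[\<I>]"] cs L Cons.prems
      by (simp add: seq_tensor_Cons' del: seq_tensor_assoc)
    ultimately show ?thesis using cs L False Cons.prems
      by (auto simp: seq_tensor_Cons' act_Cons walk_of_Cons simp del: walk_of.simps intro!:
          path_eq_Cons)
  qed
qed auto

lemma walk_of_run:
  assumes "path u es v" "chain X u cs"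
  shows "path_eq [X] v (walk_of v (run es cs)) (walk_of u cs @ es)"
  using assms
proof (induction u es v arbitrary: cs rule: path.induct)
  case (1 u v)
  then show ?case by (auto intro: path_eq_refl path_walk_of)
next
  case (2 u L p R es v)
  then have c: "chain X (L \<odot> (src p \<odot> R)) cs" "L \<in> seqs C" "R \<in> seqs C" "p \<in> prims"
    "path (L \<odot> (tgt p \<odot> R)) es v" "u = L \<odot> (src p \<odot> R)" by auto
  have "path_eq [X] v (walk_of v (run es (act L p R cs))) (walk_of (L \<odot> (tgt p \<odot> R)) (act L p R cs)
      @ es)"
    using 2 c act_chain by simp
  also have "path_eq [X] v \<dots> ((walk_of u cs @ [(L, p, R)]) @ es)"
    using path_eq_append[OF walk_of_act[OF c(1-4)] path_eq_refl[OF c(5)]] c by simp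
  finally show ?case by simp
qed

section \<open>Paths and chains as mutually inverse descriptions\<close>

definition start :: "'o \<Rightarrow> ('m \<times> 'o) list" where
  "start X = [(Ident C X, \<I>)]"

lemma chain_start: "X \<in> Obj C \<Longrightarrow> chain X [X] (start X)"
  by (simp add: start_def)

text \<open>The walk of the identity chain is a single bar of an identity, hence congruent to the
  empty path, and running \<open>es\<close> appends \<open>es\<close> to it.\<close>

lemma walk_of_run_start:
  assumes "path [X] es v"
  shows "path_eq [X] v (walk_of v (run es (start X))) es"
proof -
  have X: "X \<in> Obj C" using path_seqs[OF assms] by simp
  have "path_eq [X] v (walk_of v (run es (start X))) (walk_of [X] (start X) @ es)"
    using walk_of_run[OF assms chain_start[OF X]] .
  also have "path_eq [X] v \<dots> ([] @ es)"
    using path_eq_bar_Ident[OF X, of "[\<I>]" "[\<I>]"] X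
    by (intro path_eq_append[OF _ path_eq_refl[OF assms]]) (simp add: start_def)
  finally show ?thesis by simp
qed

text \<open>The bar writes \<open>g\<close> into the identity entry, and the unit splits off a fresh
  identity entry over \<open>J \<otimes> Y\<close>. The remaining walk acts beyond the first entry,
  as it does on \<open>start (J \<otimes> Y)\<close>.\<close>

lemma run_walk_of:
  "chain X V cs \<Longrightarrow> chain_eq X V (run (walk_of V cs) (start X)) cs"
proof (induction X V cs rule: chain.induct)
  case (1 X A V g Y cs)
  show ?case
  proof (cases "V = []")
    case True
    then show ?thesis using 1 by (auto simp: start_def intro!: chain_eq.refl)
  next
    case False
    then have c: "chain (J \<otimes>\<^sub>o Y) V cs" "A \<in> Obj C" "Y \<in> Obj C" "g \<in> Arr C" "Dom C g = X"
        "Cod C g = A \<otimes>\<^sub>o Y"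
      using 1 by auto
    have IH: "chain_eq (J \<otimes>\<^sub>o Y) V (run (walk_of V cs) (start (J \<otimes>\<^sub>o Y))) cs"
      using 1 False by simp
    have "run (walk_of (A # V) ((g, Y) # cs)) (start X) =
        run (whisk [A, \<I>] [\<I>] (walk_of V cs)) ((g, Y) # start (J \<otimes>\<^sub>o Y))"
      using c by (simp add: walk_of_Cons start_def del: walk_of.simps)
    also have "\<dots> = (g, Y) # run (walk_of V cs) (start (J \<otimes>\<^sub>o Y))"
      using path_walk_of[OF c(1)] by (simp add: run_whisk_Cons whisk_unit)
    finally show ?thesis using IH c by (auto simp: Hom_iff intro: chain_eq.Cons)
  qed
qed auto

section \<open>The coend\<close>

abbreviation cls :: "'o list \<Rightarrow> ('o, 'm) edge list \<Rightarrow> 'o list \<Rightarrow> ('o, 'm) edge_seq set" where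
  "cls u es v \<equiv> dual_class C J (u, es, v)"

lemma cls_conv: "cls u es v = {(u, es', v) | es'. path_eq u v es es'}"
  by (auto simp: dual_class_def cong_class_def path_eq_def elim: congruence_paths)

lemma cls_eqI: "path_eq u v es es' \<Longrightarrow> cls u es v = cls u es' v"
  unfolding cls_conv using path_eq_sym[of u v es es'] path_eq_trans[of u v es es'] path_eq_trans[of
      u v es' es] by auto

lemma cls_eqD: "path u es' v \<Longrightarrow> cls u es v = cls u es' v \<Longrightarrow> path_eq u v es es'"
proof -
  assume "path u es' v" "cls u es v = cls u es' v"
  then have "(u, es', v) \<in> cls u es v" by (simp add: cls_conv path_eq_refl)
  then show "path_eq u v es es'" by (simp add: cls_conv)
qed

abbreviation D where "D \<equiv> adjoin_dual C J"

lemma D_sel: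
  "Obj D = seqs C"
  "Arr D = dual_class C J ` Arr F"
  "Dom D = (\<lambda>A. the_elem (Dom F ` A))"
  "Cod D = (\<lambda>A. the_elem (Cod F ` A))"
  "Ident D a = cls a [] a"
  "Comp D B A = (\<Union>g\<in>B. \<Union>f\<in>A. dual_class C J (Comp F g f))"
  "tensor_arr D A B = (\<Union>a\<in>A. \<Union>b\<in>B. dual_class C J (path_tensor C J a b))"
  by (auto simp: adjoin_dual_def quotient_cat_def dual_class_def cat.defs monoidal_cat.defs)

lemma cls_ends:
  assumes "path u es v"
  shows "Dom D (cls u es v) = u" "Cod D (cls u es v) = v"
proof -
  have "Dom F ` cls u es v = {u}" "Cod F ` cls u es v = {v}"
    using path_eq_refl[OF assms] by (auto simp: cls_conv image_iff)
  then show "Dom D (cls u es v) = u" "Cod D (cls u es v) = v" by (auto simp: D_sel)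
qed

lemma Hom_D: "Hom D u v = {cls u es v | es. path u es v}"
  by (auto simp: Hom_def D_sel(2) cls_ends)

text \<open>Composition and tensor of classes are unions over all representatives; this evaluates
  them once the resulting class is independent of the choice.\<close>

lemma UN_UN_const:
  assumes "A \<noteq> {}" "B \<noteq> {}" "\<And>a b. a \<in> A \<Longrightarrow> b \<in> B \<Longrightarrow> f a b = K"
  shows "(\<Union>a\<in>A. \<Union>b\<in>B. f a b) = K"
proof -
  have "(\<Union>a\<in>A. \<Union>b\<in>B. f a b) = (\<Union>a\<in>A. \<Union>b\<in>B. K)" by (intro SUP_cong HOL.refl assms(3))
  then show ?thesis using assms(1,2) by simp
qed

lemma Comp_D:
  assumes "path u a v" "path v b w"
  shows "Comp D (cls v b w) (cls u a v) = cls u (a @ b) w"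
proof -
  have "cls u (a' @ b') w = cls u (a @ b) w" if "path_eq u v a a'" "path_eq v w b b'" for a' b'
    using cls_eqI[OF path_eq_append[OF that]] by simp
  note * = this
  show ?thesis unfolding D_sel(6)
  proof (rule UN_UN_const)
    show "cls v b w \<noteq> {}" "cls u a v \<noteq> {}"
      using path_eq_refl[OF assms(1)] path_eq_refl[OF assms(2)] by (auto simp: cls_conv)
    fix g f assume "g \<in> cls v b w" "f \<in> cls u a v"
    then obtain a' b' where "g = (v, b', w)" "f = (u, a', v)" "path_eq u v a a'" "path_eq v w b b'"
      by (auto simp: cls_conv)
    with *[of a' b'] show "dual_class C J (Comp F g f) = cls u (a @ b) w" by simp
  qed
qed

lemma path_tensor_eq:
  assumes "path u a v" "path u' b v'"
  shows "path_tensor C J (u, a, v) (u', b, v') =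
    (u \<odot> u', whisk [\<I>] u' a @ whisk v [\<I>] b, v \<odot> v')"
proof -
  note s = path_seqs[OF assms(1)] path_seqs[OF assms(2)]
  have "whisker_left C v (u', b, v') = (v \<odot> u', whisk v [\<I>] b, v \<odot> v')"
    using s by (simp add: whisker_eq[OF assms(2)] seq_unit_def)
  moreover have "whisker_right C (u, a, v) u' = (u \<odot> u', whisk [\<I>] u' a, v \<odot> u')"
    using s by (simp add: whisker_eq[OF assms(1)] seq_unit_def)
  ultimately show ?thesis by (simp add: path_tensor_def)
qed

lemma tensor_D:
  assumes "path u a v" "path u' b v'"
  shows "tensor_arr D (cls u a v) (cls u' b v') =
    cls (u \<odot> u') (whisk [\<I>] u' a @ whisk v [\<I>] b) (v \<odot> v')"
proof -
  note s = path_seqs[OF assms(1)] path_seqs[OF assms(2)]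
  have "dual_class C J (path_tensor C J (u, a', v) (u', b', v')) =
      cls (u \<odot> u') (whisk [\<I>] u' a @ whisk v [\<I>] b) (v \<odot> v')"
    if "path_eq u v a a'" "path_eq u' v' b b'" for a' b'
  proof -
    have "path_eq (u \<odot> u') (v \<odot> u') (whisk [\<I>] u' a') (whisk [\<I>] u' a)"
      using path_eq_whisk[OF path_eq_sym[OF that(1)], of "[\<I>]" u'] s by simp
    moreover have "path_eq (v \<odot> u') (v \<odot> v') (whisk v [\<I>] b') (whisk v [\<I>] b)"
      using path_eq_whisk[OF path_eq_sym[OF that(2)], of v "[\<I>]"] s by simp
    ultimately show ?thesis
      using path_tensor_eq[OF path_eqD(2)[OF that(1)] path_eqD(2)[OF that(2)]]
        cls_eqI[OF path_eq_append] by metis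
  qed
  note * = this
  show ?thesis unfolding D_sel(7)
  proof (rule UN_UN_const)
    show "cls u a v \<noteq> {}" "cls u' b v' \<noteq> {}"
      using path_eq_refl[OF assms(1)] path_eq_refl[OF assms(2)] by (auto simp: cls_conv)
    fix f g assume "f \<in> cls u a v" "g \<in> cls u' b v'"
    then obtain a' b' where "f = (u, a', v)" "g = (u', b', v')" "path_eq u v a a'"
        "path_eq u' v' b b'"
      by (auto simp: cls_conv)
    with *[of a' b'] show "dual_class C J (path_tensor C J f g) =
      cls (u \<odot> u') (whisk [\<I>] u' a @ whisk v [\<I>] b) (v \<odot> v')" by simp
  qed
qed

lemma dual_unit_eq: "dual_unit C J = cls [\<I>] [([\<I>], Unit, [\<I>])] [\<I>, J]"
  by (simp add: dual_unit_def prim_path_eq)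

lemma incl_arr_eq: "f \<in> Hom C A B \<Longrightarrow> incl_arr C J f = cls [A] [([\<I>], Bar f, [\<I>])] [B]"
  by (simp add: incl_arr_def prim_path_eq Hom_iff)

text \<open>Tensoring with identities leaves a single \<open>whisk\<close> by
  \<open>[A, \<I>]\<close>, so the composite has the shape of \<open>walk_of_Cons\<close>.\<close>

lemma zeta_composite_eq:
  assumes "A \<in> Obj C" "f \<in> Hom C U0 (A \<otimes>\<^sub>o Y)" "Y \<in> Obj C" "path [J \<otimes>\<^sub>o Y] es V"
  shows "zeta_composite C J (A # V) Y f (cls [J \<otimes>\<^sub>o Y] es V) =
    cls [U0] (([\<I>], Bar f, [\<I>]) # ([A], Unit, [Y]) # whisk [A, \<I>] [\<I>] es) (A # V)"
proof -
  have V: "V \<in> seqs C" using path_seqs[OF assms(4)] by simp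
  have f: "f \<in> Arr C" "Dom C f = U0" "Cod C f = A \<otimes>\<^sub>o Y" "U0 \<in> Obj C" using assms(2) by (auto simp:
      Hom_iff)
  have 1: "Ident D [A] \<otimes>\<^bsub>D\<^esub> Ident D (dual_obj C) \<otimes>\<^bsub>D\<^esub> cls [J \<otimes>\<^sub>o Y] es V =
      cls [A, J \<otimes>\<^sub>o Y] (whisk [A, \<I>] [\<I>] es) (A # V)"
    using assms V by (simp add: D_sel(5) tensor_D dual_obj_def seq_tensor_Cons')
  have 2: "Ident D [A] \<otimes>\<^bsub>D\<^esub> dual_unit C J \<otimes>\<^bsub>D\<^esub> Ident D [Y] =
      cls [A \<otimes>\<^sub>o Y] [([A], Unit, [Y])] [A, J \<otimes>\<^sub>o Y]"
    using assms by (simp add: D_sel(5) dual_unit_eq tensor_D)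
  have "path [A, J \<otimes>\<^sub>o Y] (whisk [A, \<I>] [\<I>] es) (A # V)"
    using path_whisk[OF assms(4), of "[A, \<I>]" "[\<I>]"] assms V by (simp add: seq_tensor_Cons')
  then show ?thesis using assms f
    by (simp add: zeta_composite_def Let_def 1 2 incl_arr_eq[OF assms(2)] Comp_D)
qed

lemma zeta_composite_chain:
  assumes "chain X (A # V) ((g, Y) # cs)" "V \<noteq> []"
  shows "zeta_composite C J (A # V) Y g (cls [J \<otimes>\<^sub>o Y] (walk_of V cs) V) =
    cls [X] (walk_of (A # V) ((g, Y) # cs)) (A # V)"
proof -
  have c: "chain (J \<otimes>\<^sub>o Y) V cs" "A \<in> Obj C" "Y \<in> Obj C" "g \<in> Hom C X (A \<otimes>\<^sub>o Y)"
    using assms by (auto simp: Hom_iff)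
  then show ?thesis using zeta_composite_eq[OF c(2,4,3) path_walk_of[OF c(1)]]
    by (simp add: walk_of_Cons del: walk_of.simps)
qed

lemma path_eq_run:
  assumes "path_eq u v es es'" "chain X u cs"
  shows "chain_eq X v (run es cs) (run es' cs)"
proof -
  note p = path_eqD[OF assms(1)]
  have "\<forall>T W X cs. T \<in> seqs C \<longrightarrow> W \<in> seqs C \<longrightarrow> chain X (T \<odot> (u \<odot> W)) cs \<longrightarrow>
      chain_eq X (T \<odot> (v \<odot> W)) (run (whisk T W es) cs) (run (whisk T W es') cs)"
    using sound_congruence[OF assms(1)[unfolded path_eq_def]] by (simp add: sound_def)
  from this[rule_format, of "[\<I>]" "[\<I>]" X cs]
  show ?thesis using assms(2) p path_seqs[OF p(1)] by (simp add: whisk_unit)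
qed

text \<open>Run both walks on the identity chain: soundness makes the results agree up to sliding,
  and each run gives its own chain back.\<close>

lemma chain_eq_if_path_eq:
  assumes "chain X V cs" "chain X V cs'" "path_eq [X] V (walk_of V cs) (walk_of V cs')"
  shows "chain_eq X V cs cs'"
proof -
  have "chain_eq X V (run (walk_of V cs) (start X)) (run (walk_of V cs') (start X))"
    using path_eq_run[OF assms(3) chain_start[OF chain_Obj[OF assms(1)]]] .
  then show ?thesis using run_walk_of[OF assms(1)] run_walk_of[OF assms(2)]
    by (meson chain_eq.sym chain_eq.trans)
qed

section \<open>Chains as elements of the coend\<close>

text \<open>Only the first link is kept; the tail is read as a morphism out of
  \<open>[J \<otimes> Y]\<close>, so slides inside the tail become invisible. The value at
  \<open>[]\<close> is arbitrary, as no chain is empty.\<close>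

fun coend_elem :: "'o list \<Rightarrow> ('m \<times> 'o) list \<Rightarrow> 'o \<times> 'm \<times> ('o, 'm) edge_seq set" where
  "coend_elem V ((g, Y) # cs) = (Y, g, cls [J \<otimes>\<^sub>o Y] (walk_of V cs) V)"
| "coend_elem V [] = undefined"

abbreviation zeta_rel where
  "zeta_rel U0 V \<equiv> coend_rel C (zeta_fun C J U0 V) (zeta_fun_map C J V)"

lemma zeta_rel_refl: "(z, z) \<in> zeta_rel U0 V"
  by (simp add: coend_rel_def)

lemma zeta_rel_sym: "(z, z') \<in> zeta_rel U0 V \<Longrightarrow> (z', z) \<in> zeta_rel U0 V"
  unfolding coend_rel_def by (meson sym_Un_converse sym_rtrancl symD)

lemma zeta_rel_trans:
    "(z, z') \<in> zeta_rel U0 V \<Longrightarrow> (z', z'') \<in> zeta_rel U0 V \<Longrightarrow> (z, z'') \<in> zeta_rel U0 V"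
  unfolding coend_rel_def by (rule rtrancl_trans)

lemma coend_elem_mem:
  assumes "chain X (A # V) c" "V \<noteq> []"
  shows "coend_elem V c \<in> (SIGMA Y:Obj C. zeta_fun C J X (A # V) Y Y)"
proof -
  obtain g Y cs where c: "c = (g, Y) # cs" "g \<in> Hom C X (A \<otimes>\<^sub>o Y)" "Y \<in> Obj C"
    "chain (J \<otimes>\<^sub>o Y) V cs"
    using assms by (auto elim!: chain_ConsE simp: Hom_iff)
  then show ?thesis using path_walk_of[OF c(4)] by (auto simp: zeta_fun_def Hom_D)
qed

lemma coend_elem_ex:
  assumes "z \<in> (SIGMA Y:Obj C. zeta_fun C J X (A # V) Y Y)" "A \<in> Obj C" "V \<noteq> []"
  obtains c where "chain X (A # V) c" "z = coend_elem V c"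
proof -
  obtain Y g es where z: "z = (Y, g, cls [J \<otimes>\<^sub>o Y] es V)" "Y \<in> Obj C" "g \<in> Hom C X (A \<otimes>\<^sub>o Y)"
      "path [J \<otimes>\<^sub>o Y] es V"
    using assms(1) by (auto simp: zeta_fun_def Hom_D)
  \<comment> \<open>Running a representative on the identity chain supplies the tail; its walk is
    congruent to \<open>es\<close>, so the class is unchanged.\<close>
  let ?c = "(g, Y) # run es (start (J \<otimes>\<^sub>o Y))"
  have "chain (J \<otimes>\<^sub>o Y) V (run es (start (J \<otimes>\<^sub>o Y)))" using run_chain[OF z(4) chain_start] z(2) by
      simp
  then have "chain X (A # V) ?c" using z assms by (simp add: Hom_iff)
  moreover have "z = coend_elem V ?c" using z cls_eqI[OF walk_of_run_start[OF z(4)]] by simp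
  ultimately show ?thesis using that by blast
qed

text \<open>The two legs of a generator of the coend are the two sides of a slide at the first
  \<open>J\<close>. In the first leg an identity bar disappears; in the second, the first bar of the
  tail absorbs \<open>J \<otimes> k\<close>.\<close>

lemma zeta_fun_map_chain:
  assumes "k \<in> Hom C Y Y'" "chain (J \<otimes>\<^sub>o Y') V cs" "g \<in> Hom C X (A \<otimes>\<^sub>o Y)" "A \<in> Obj C"
  defines "G \<equiv> cls [J \<otimes>\<^sub>o Y'] (walk_of V cs) V"
  shows "(Y', zeta_fun_map C J (A # V) (Ident C Y') k (g, G)) = coend_elem V (((Ident C A \<otimes> k) \<cdot> g,
      Y') # cs)"
    "(Y, zeta_fun_map C J (A # V) k (Ident C Y) (g, G)) =
      coend_elem V ((g, Y) # precomp (Ident C J \<otimes> k) cs)"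
proof -
  have k: "k \<in> Arr C" "Dom C k = Y" "Cod C k = Y'" "Y \<in> Obj C" "Y' \<in> Obj C" using assms by (auto
      simp: Hom_iff)
  note p = path_walk_of[OF assms(2)]
  have incl: "incl_arr C J (Ident C J \<otimes> k) = cls [J \<otimes>\<^sub>o Y] [([\<I>], Bar (Ident C J \<otimes> k), [\<I>])] [J \<otimes>\<^sub>o
      Y']"
    "incl_arr C J (Ident C (J \<otimes>\<^sub>o Y')) = cls [J \<otimes>\<^sub>o Y'] [([\<I>], Bar (Ident C (J \<otimes>\<^sub>o Y')), [\<I>])] [J
        \<otimes>\<^sub>o Y']"
    using k by (auto intro!: incl_arr_eq simp: Hom_iff)
  have "path_eq [J \<otimes>\<^sub>o Y'] V ([([\<I>], Bar (Ident C (J \<otimes>\<^sub>o Y')), [\<I>])] @ walk_of V cs) ([] @ walk_of V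
      cs)"
    using path_eq_bar_Ident[of "J \<otimes>\<^sub>o Y'" "[\<I>]" "[\<I>]"] k by (intro path_eq_append[OF _
        path_eq_refl[OF p]]) simp
  then show "(Y', zeta_fun_map C J (A # V) (Ident C Y') k (g, G)) = coend_elem V (((Ident C A \<otimes> k) \<cdot>
      g, Y') # cs)"
    using k p by (simp add: zeta_fun_map_def incl Comp_D cls_eqI G_def)
  have "path_eq [J \<otimes>\<^sub>o Y] V (walk_of V (precomp (Ident C J \<otimes> k) cs)) (([\<I>], Bar (Ident C J \<otimes> k),
      [\<I>]) # walk_of V cs)"
    using assms k by (intro walk_of_precomp) (auto simp: Hom_iff)
  then show "(Y, zeta_fun_map C J (A # V) k (Ident C Y) (g, G)) =
      coend_elem V ((g, Y) # precomp (Ident C J \<otimes> k) cs)"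
    using k p assms by (simp add: zeta_fun_map_def incl Comp_D cls_eqI Hom_iff G_def)
qed

text \<open>A slide at the first \<open>J\<close> is a generator of the coend relation, while a
  change in the tail does not alter the class of its walk and leaves the element fixed.\<close>

lemma chain_eq_zeta_rel:
  assumes "chain_eq X W c c'" "W = A # V" "V \<noteq> []"
  shows "(coend_elem V c, coend_elem V c') \<in> zeta_rel X W"
  using assms
proof (induction rule: chain_eq.induct)
  case (slide g X A' Y k Y' V' cs)
  let ?M = "zeta_fun_map C J (A # V)" and ?G = "cls [J \<otimes>\<^sub>o Y'] (walk_of V cs) V"
  have V: "A' = A" "V' = V" using slide by auto
  have k: "k \<in> Arr C" "Dom C k = Y" "Cod C k = Y'" using slide by (auto simp: Hom_iff)
  have "(g, ?G) \<in> zeta_fun C J X (A # V) Y' Y"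
    using slide path_walk_of[OF slide(4)] V by (auto simp: zeta_fun_def Hom_D)
  then have "((Y, ?M k (Ident C Y) (g, ?G)), (Y', ?M (Ident C Y') k (g, ?G))) \<in>
      coend_gen C (zeta_fun C J X (A # V)) ?M"
    using k by (auto simp: coend_gen_def)
  then show ?case using zeta_fun_map_chain[OF slide(3,4,1,2)] V
    unfolding coend_rel_def by auto
next
  case (Cons g X A' Y V' cs cs')
  then show ?case using cls_eqI[OF walk_of_chain_eq[OF Cons(4)]] by (simp add: zeta_rel_refl)
next
  case (trans X V' cs cs' cs'')
  then show ?case using zeta_rel_trans by blast
qed (auto intro: zeta_rel_refl zeta_rel_sym)

abbreviation composite where
  "composite V \<equiv> \<lambda>(Y, f, g). zeta_composite C J V Y f g"

lemma composite_coend_elem: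
  assumes "chain X (A # V) c" "V \<noteq> []"
  shows "composite (A # V) (coend_elem V c) = cls [X] (walk_of (A # V) c) (A # V)"
  using assms zeta_composite_chain by (auto elim!: chain_ConsE simp del: walk_of.simps)

text \<open>Represent the morphism out of \<open>[J \<otimes> Cod C k]\<close> by the walk of a
  chain: the generator then becomes a slide, and sliding preserves the class of the walk.\<close>

lemma coend_gen_composite:
  assumes "(z, z') \<in> coend_gen C (zeta_fun C J X (A # V)) (zeta_fun_map C J (A # V))" "A \<in> Obj C"
      "V \<noteq> []"
  shows "composite (A # V) z = composite (A # V) z'"
proof -
  obtain k g es where k: "k \<in> Arr C" "g \<in> Hom C X (A \<otimes>\<^sub>o Dom C k)" "path [J \<otimes>\<^sub>o Cod C k] es V"
    and z: "z = (Dom C k, zeta_fun_map C J (A # V) k (Ident C (Dom C k)) (g, cls [J \<otimes>\<^sub>o Cod C k] es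
        V))"
      "z' = (Cod C k, zeta_fun_map C J (A # V) (Ident C (Cod C k)) k (g, cls [J \<otimes>\<^sub>o Cod C k] es V))"
    using assms(1) by (auto simp: coend_gen_def zeta_fun_def Hom_D)
  let ?cs = "run es (start (J \<otimes>\<^sub>o Cod C k))"
  have cs: "chain (J \<otimes>\<^sub>o Cod C k) V ?cs" using run_chain[OF k(3) chain_start] k(1) by simp
  have G: "cls [J \<otimes>\<^sub>o Cod C k] es V = cls [J \<otimes>\<^sub>o Cod C k] (walk_of V ?cs) V"
    using cls_eqI[OF walk_of_run_start[OF k(3)]] by simp
  have k': "k \<in> Hom C (Dom C k) (Cod C k)" using k by (simp add: Hom_iff)
  let ?c = "((Ident C A \<otimes> k) \<cdot> g, Cod C k) # ?cs" and ?c' =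
      "(g, Dom C k) # precomp (Ident C J \<otimes> k) ?cs"
  have eq: "chain_eq X (A # V) ?c ?c'" using k(2) assms(2) k' cs by (rule chain_eq.slide)
  have "z' = coend_elem V ?c" "z = coend_elem V ?c'"
    unfolding z G using zeta_fun_map_chain[OF k' cs k(2) assms(2)] by auto
  moreover have "composite (A # V) (coend_elem V ?c') = composite (A # V) (coend_elem V ?c)"
    using chain_eq_chain[OF eq, THEN conjunct1, THEN composite_coend_elem, OF assms(3)]
      chain_eq_chain[OF eq, THEN conjunct2, THEN composite_coend_elem, OF assms(3)]
      cls_eqI[OF walk_of_chain_eq[OF eq]] by (simp only:)
  ultimately show ?thesis by (simp only:)
qed

lemma zeta_rel_composite:
  assumes "(z, z') \<in> zeta_rel X (A # V)" "A \<in> Obj C" "V \<noteq> []"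
  shows "composite (A # V) z = composite (A # V) z'"
  using assms(1) unfolding coend_rel_def
proof (induction rule: rtrancl_induct)
  case (step y z')
  from step.hyps(2) have "composite (A # V) y = composite (A # V) z'"
  proof (elim UnE)
    assume "(y, z') \<in> coend_gen C (zeta_fun C J X (A # V)) (zeta_fun_map C J (A # V))"
    from this assms(2,3) show ?thesis by (rule coend_gen_composite)
  next
    assume "(y, z') \<in> (coend_gen C (zeta_fun C J X (A # V)) (zeta_fun_map C J (A # V)))\<inverse>"
    then have "(z', y) \<in> coend_gen C (zeta_fun C J X (A # V)) (zeta_fun_map C J (A # V))" by simp
    from this assms(2,3) show ?thesis by (rule coend_gen_composite[symmetric])
  qed
  with step.IH show ?case by (rule HOL.trans)
qed (rule HOL.refl)

section \<open>Bijectivity of \<open>zeta\<close>\<close>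

lemma zeta_coend_class:
  assumes "A \<in> Obj C" "V \<noteq> []"
  shows "zeta C J (A # V) (zeta_rel X (A # V) `` {z}) = composite (A # V) z"
proof -
  have "z \<in> zeta_rel X (A # V) `` {z}" using zeta_rel_refl by simp
  moreover have "composite (A # V) w = composite (A # V) z" if "w \<in> zeta_rel X (A # V) `` {z}" for w
    using zeta_rel_composite[of z w X A V, OF _ assms] that by simp
  \<comment> \<open>The composite is constant on the class, so its image is a singleton and
    \<open>the_elem\<close> returns that value.\<close>
  ultimately show ?thesis unfolding zeta_def by (intro the_elem_image_unique) blast+
qed

text \<open>On the class of a chain, \<open>zeta\<close> returns the class of its walk. Congruent
  walks come from chains equal up to sliding, hence from one coend class, and every morphism is the
  class of such a walk.\<close>

lemma bij_betw_zeta: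
  assumes "A \<in> Obj C" "V \<noteq> []" "X \<in> Obj C"
  shows "bij_betw (zeta C J (A # V)) (zeta_dom C J X (A # V)) (Hom D [X] (A # V))"
proof -
  let ?S = "SIGMA Y:Obj C. zeta_fun C J X (A # V) Y Y"
  have dom: "zeta_dom C J X (A # V) = {zeta_rel X (A # V) `` {coend_elem V c} | c. chain X (A # V)
      c}" (is "_ = ?Q")
  proof -
    have "?S = {coend_elem V c | c. chain X (A # V) c}"
      using coend_elem_mem[of X A V] coend_elem_ex[of _ X A V] assms by blast
    then show ?thesis by (auto simp: coend_def quotient_def)
  qed
  have zeta: "zeta C J (A # V) (zeta_rel X (A # V) `` {coend_elem V c}) = cls [X] (walk_of (A # V)
      c) (A # V)"
    if "chain X (A # V) c" for c
    using that zeta_coend_class composite_coend_elem assms by simp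
  have "inj_on (zeta C J (A # V)) ?Q"
  proof (rule inj_onI)
    fix q q' assume "q \<in> ?Q" "q' \<in> ?Q" and eq: "zeta C J (A # V) q = zeta C J (A # V) q'"
    then obtain c c' where c: "chain X (A # V) c" "q = zeta_rel X (A # V) `` {coend_elem V c}"
      "chain X (A # V) c'" "q' = zeta_rel X (A # V) `` {coend_elem V c'}" by blast
    have "path_eq [X] (A # V) (walk_of (A # V) c) (walk_of (A # V) c')"
      using eq c zeta path_walk_of by (intro cls_eqD) auto
    then have "chain_eq X (A # V) c c'" using c by (intro chain_eq_if_path_eq)
    then have "(coend_elem V c, coend_elem V c') \<in> zeta_rel X (A # V)" using assms by (intro
        chain_eq_zeta_rel) auto
    then show "q = q'" using c zeta_rel_sym zeta_rel_trans by blast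
  qed
  moreover have "zeta C J (A # V) ` ?Q = Hom D [X] (A # V)"
  proof (intro equalityI subsetI)
    fix a assume "a \<in> zeta C J (A # V) ` ?Q"
    then show "a \<in> Hom D [X] (A # V)" using zeta path_walk_of by (auto simp: Hom_D)
  next
    fix a assume "a \<in> Hom D [X] (A # V)"
    then obtain es where es: "path [X] es (A # V)" "a = cls [X] es (A # V)" by (auto simp: Hom_D)
    let ?c = "run es (start X)"
    have c: "chain X (A # V) ?c" using run_chain[OF es(1) chain_start[OF assms(3)]] .
    have "a = zeta C J (A # V) (zeta_rel X (A # V) `` {coend_elem V ?c})"
      using zeta[OF c] es cls_eqI[OF walk_of_run_start[OF es(1)]] by simp
    then show "a \<in> zeta C J (A # V) ` ?Q" using c by blast
  qed
  ultimately show ?thesis unfolding dom by (simp add: bij_betw_def)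
qed

end

theorem corollary19:
  fixes C :: "('o, 'm) monoidal_cat"
    and J U0 :: 'o and V :: "'o list" and n :: nat
  assumes "strict_monoidal_category C"
    and "J \<in> Obj C"
    and "n > 0"
    and "U0 \<in> Obj C"
    and "V \<in> Obj (adjoin_dual C J)"
    and "length V = n + 1"
  shows "(\<forall>Y\<in>Obj C. \<forall>f\<in>Hom C U0 (hd V \<otimes>\<^sub>o\<^bsub>C\<^esub> Y).
            \<forall>g\<in>Hom (adjoin_dual C J) [J \<otimes>\<^sub>o\<^bsub>C\<^esub> Y] (tl V).
              zeta C J V (zeta_class C J U0 V Y f g) = zeta_composite C J V Y f g) \<and>
         bij_betw (zeta C J V) (zeta_dom C J U0 V) (Hom (adjoin_dual C J) [U0] V)"
proof -
  interpret dual_adjunction C J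
    using assms(1,2) by (simp add: dual_adjunction_def dual_adjunction_axioms_def)
  \<comment> \<open>\<open>n > 0\<close> gives \<open>V\<close> at least two entries, so its tail is
    nonempty.\<close>
  obtain A V' where V: "V = A # V'" "V' \<noteq> []" "A \<in> Obj C"
    using assms(3,5,6) by (cases V) (auto simp: D_sel(1))
  show ?thesis using bij_betw_zeta[OF V(3,2) assms(4)] zeta_coend_class[OF V(3,2)] V
    by (simp add: coend_class_def)
qed

end
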